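(* Let $n\ge 1$, let $a_0,\dots,a_{n-1}\in\mathbb R$, and let $f_s(x)=x^n+a_{n-1}x^{n-1}+\dots+a_1x+a_0$. Let $S$ be the set of all $X\in M_3(\mathbb R)$ satisfying $$X^n+a_{n-1}X^{n-1}+\dots+a_1X+a_0 I=O .$$ Then $S$ is $\sigma$-compact, and $\dim S$ is equal to $-1$ or it is the maximum of the dimensions of the following sets $S(J)$, i.e. $0$, $4$ or $6$: (1) $S(J(a,b,c))$, whenever $a,b,c$ are distinct real roots of $f_s(x)=0$; (2) $S(J(a,a,b))$, whenever $a,b$ are distinct real roots of $f_s(x)=0$; (3) $S(J_1(a,a,b))$, whenever $a,b$ are distinct real roots of $f_s(x)=0$ and $a$ is a root of multiplicity $\ge 2$; (4) $S(J(a,a,a))$, whenever $a$ is a real root of $f_s(x)=0$; (5) $S(J_1(a,a,a))$, whenever $a$ is a real root of $f_s(x)=0$ of multiplicity $\ge 2$; (6) $S(J_2(a,a,a))$, whenever $a$ is a real root of $f_s(x)=0$ of multiplicity $\ge 3$; (7) $S(J_c(a,p,q))$ with $p,q\in\mathbb R$, $q>0$, whenever $a$ is a real root of $f_s(x)=0$ and $p\pm iq$ are non-real roots of $f_s(x)=0$.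
   Context: $M_3(\mathbb R)$ is the algebra of real $3\times 3$ matrices with its Euclidean topology (homeomorphic to $\mathbb R^{9}$); subsets carry the subspace topology. $GL_3(\mathbb R)$ is the group of invertible matrices, $I$ the identity matrix, $O$ the null matrix. $\dim$ denotes covering dimension, with $\dim\emptyset=-1$. For $B\in M_3(\mathbb R)$, $S(B)=\{X^{-1}BX : X\in GL_3(\mathbb R)\}$. For distinct real numbers $a,b,c$ and real numbers $p,q$ with $q\neq 0$: $$J(a,b,c)=\begin{pmatrix} a&0&0\\0&b&0\\0&0&c\end{pmatrix},\quad J(a,a,b)=\begin{pmatrix} a&0&0\\0&a&0\\0&0&b\end{pmatrix},\quad J_1(a,a,b)=\begin{pmatrix} a&1&0\\0&a&0\\0&0&b\end{pmatrix},$$ $$J(a,a,a)=\begin{pmatrix} a&0&0\\0&a&0\\0&0&a\end{pmatrix},\quad J_1(a,a,a)=\begin{pmatrix} a&1&0\\0&a&0\\0&0&a\end{pmatrix},\quad J_2(a,a,a)=\begin{pmatrix} a&1&0\\0&a&1\\0&0&a\end{pmatrix},$$ $$J_c(a,p,q)=\begin{pmatrix} a&0&0\\0&p&q\\0&-q&p\end{pmatrix}.$$ *)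

theory Defs
  imports
    "HOL-Analysis.Analysis"
    "HOL-Library.Extended_Real"
    "HOL-Computational_Algebra.Polynomial"
begin

section \<open>Covering dimension and sigma-compactness\<close>

definition finite_open_cover :: "'a topology \<Rightarrow> 'a set set \<Rightarrow> bool" where
  "finite_open_cover X \<U> \<longleftrightarrow>
     finite \<U> \<and> (\<forall>U\<in>\<U>. openin X U) \<and> \<Union>\<U> = topspace X"

text \<open>
  A finite family has order at most \<open>n\<close> if no point lies in more than \<open>n + 1\<close> of its members.
  For \<open>n = -1\<close> this says that all members are empty, so only the empty space has
  covering dimension at most \<open>-1\<close>.
\<close>

definition covering_dim_le :: "'a topology \<Rightarrow> int \<Rightarrow> bool" where
  "covering_dim_le X n \<longleftrightarrow> - 1 \<le> n \<and>
     (\<forall>\<U>. finite_open_cover X \<U> \<longrightarrow>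
        (\<exists>\<V>. finite_open_cover X \<V> \<and>
             (\<forall>V\<in>\<V>. \<exists>U\<in>\<U>. V \<subseteq> U) \<and>
             (\<forall>x. int (card {V \<in> \<V>. x \<in> V}) \<le> n + 1)))"

text \<open>
  The values are \<open>-1, 0, 1, 2, \<dots>, \<infinity>\<close>; the value \<open>\<infinity>\<close> arises as the infimum of the empty set.
\<close>

definition covering_dim :: "'a topology \<Rightarrow> ereal" where
  "covering_dim X = Inf {ereal (real_of_int n) | n. covering_dim_le X n}"

definition sigma_compact_space :: "'a topology \<Rightarrow> bool" where
  "sigma_compact_space X \<longleftrightarrow>
     (\<exists>\<K>. countable \<K> \<and> (\<forall>K\<in>\<K>. compactin X K) \<and> \<Union>\<K> = topspace X)"

section \<open>Matrix equations and similarity classes\<close>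

text \<open>
  The library power \<open>X ^ k\<close> on \<^typ>\<open>real^3^3\<close> is taken entrywise, hence a separate matrix power.
\<close>

primrec matpow :: "real^'n^'n \<Rightarrow> nat \<Rightarrow> real^'n^'n" where
  "matpow X 0 = mat 1"
| "matpow X (Suc k) = X ** matpow X k"

definition solution_set :: "nat \<Rightarrow> (nat \<Rightarrow> real) \<Rightarrow> (real^3^3) set" where
  "solution_set n a = {X. matpow X n + (\<Sum>i<n. a i *\<^sub>R matpow X i) = 0}"

definition scalar_poly :: "nat \<Rightarrow> (nat \<Rightarrow> real) \<Rightarrow> real poly" where
  "scalar_poly n a = monom 1 n + (\<Sum>i<n. monom (a i) i)"

definition sim_class :: "real^3^3 \<Rightarrow> (real^3^3) set" where
  "sim_class B = {matrix_inv X ** B ** X | X. invertible X}"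

definition J :: "real \<Rightarrow> real \<Rightarrow> real \<Rightarrow> real^3^3" where
  "J a b c = vector [vector [a, 0, 0], vector [0, b, 0], vector [0, 0, c]]"

definition J1 :: "real \<Rightarrow> real \<Rightarrow> real \<Rightarrow> real^3^3" where
  "J1 a b c = vector [vector [a, 1, 0], vector [0, b, 0], vector [0, 0, c]]"

definition J2 :: "real \<Rightarrow> real \<Rightarrow> real \<Rightarrow> real^3^3" where
  "J2 a b c = vector [vector [a, 1, 0], vector [0, b, 1], vector [0, 0, c]]"

definition Jc :: "real \<Rightarrow> real \<Rightarrow> real \<Rightarrow> real^3^3" where
  "Jc a p q = vector [vector [a, 0, 0], vector [0, p, q], vector [0, - q, p]]"

abbreviation complex_root :: "real poly \<Rightarrow> complex \<Rightarrow> bool" where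
  "complex_root f z \<equiv> poly (map_poly complex_of_real f) z = 0"

definition classes :: "real poly \<Rightarrow> (real^3^3) set set" where
  "classes f =
     {sim_class (J a b c) | a b c.
        poly f a = 0 \<and> poly f b = 0 \<and> poly f c = 0 \<and> a \<noteq> b \<and> a \<noteq> c \<and> b \<noteq> c} \<union>
     {sim_class (J a a b) | a b. poly f a = 0 \<and> poly f b = 0 \<and> a \<noteq> b} \<union>
     {sim_class (J1 a a b) | a b. poly f a = 0 \<and> poly f b = 0 \<and> a \<noteq> b \<and> 2 \<le> order a f} \<union>
     {sim_class (J a a a) | a. poly f a = 0} \<union>
     {sim_class (J1 a a a) | a. poly f a = 0 \<and> 2 \<le> order a f} \<union>
     {sim_class (J2 a a a) | a. poly f a = 0 \<and> 3 \<le> order a f} \<union>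
     {sim_class (Jc a p q) | a p q. 0 < q \<and> poly f a = 0 \<and>
        complex_root f (Complex p q) \<and> complex_root f (Complex p (- q))}"

end

theory Submission
  imports Defs
begin

text \<open>
  By the minimal polynomial a solution of \<open>f(X) = 0\<close> is similar to one of the seven normal forms, and
  conversely every such normal form is annihilated by \<open>f\<close>; so the solution set is the union of
  finitely many similarity classes (\<open>solution_set_eq_Union_classes\<close>). It is closed in a Euclidean
  space, hence \<open>\<sigma>\<close>-compact. What remains is to find the dimension of a class and of the union.

  The class of \<open>B\<close> is an orbit of the general linear group whose stabilizer is the group of units
  of the centralizer \<open>Z\<close> of \<open>B\<close>, so it should have dimension \<open>9 - dim Z\<close>. Near the identity the
  affine space \<open>I + Z\<^sup>\<bottom>\<close> is a slice: left multiplication by an element of \<open>Z\<close> moves every matrix close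
  to \<open>I\<close> into it, and in a unique way (\<open>move_into_slice\<close>, \<open>slice_transversal\<close>). Thus conjugation is
  injective on a small ball of the slice, and countably many translates of the slice parametrize the
  whole class.

  These two facts determine the covering dimension. From below: a space that contains a
  \<open>d\<close>-dimensional ball has dimension at least \<open>d\<close>, by Brouwer's fixed point theorem
  (\<open>not_covering_dim_le_if_embedded_cball\<close>). From above: if every map from \<open>X\<close> to \<open>\<real>\<^sup>d\<^sup>+\<^sup>1\<close> that is
  Lipschitz at each point has a null image, then \<open>X\<close> has dimension at most \<open>d\<close>
  (\<open>covering_dim_le_if_lipschitz_images_negligible\<close>). This condition holds for Lipschitz images of
  subsets of \<open>\<real>\<^sup>d\<close> and passes to countable unions, however the pieces lie relative to each
  other. So no sum theorem for closed sets is involved although the classes are not closed, and the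
  dimension of the union is the maximum over the classes.

  It remains to compute the centralizers: their dimension is \<open>3\<close>, \<open>5\<close> or \<open>9\<close>.
\<close>

section \<open>Pointwise Lipschitz maps and partitions of unity\<close>

text \<open>
  The constant and the neighbourhood may depend on the point, and only distances to that point are
  compared. This is weaker than being locally Lipschitz, yet still enough for null sets to have null
  images in spaces of at least the same dimension, and it is stable under composition and under division by a positive function.
\<close>

definition pointwise_lipschitz_on :: "'a::metric_space set \<Rightarrow> ('a \<Rightarrow> 'b::metric_space) \<Rightarrow> bool" where
  "pointwise_lipschitz_on X f \<longleftrightarrow>
     (\<forall>x\<in>X. \<exists>B. \<exists>e>0. \<forall>y\<in>X. dist y x < e \<longrightarrow> dist (f y) (f x) \<le> B * dist y x)"

lemma pointwise_lipschitz_onD: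
  assumes "pointwise_lipschitz_on X f" "x \<in> X"
  shows "\<exists>B>0. \<exists>e>0. \<forall>y\<in>X. dist y x < e \<longrightarrow> dist (f y) (f x) \<le> B * dist y x"
proof -
  obtain B e where "0 < e" and B: "\<forall>y\<in>X. dist y x < e \<longrightarrow> dist (f y) (f x) \<le> B * dist y x"
    using assms unfolding pointwise_lipschitz_on_def by blast
  have "dist (f y) (f x) \<le> (\<bar>B\<bar> + 1) * dist y x" if "y \<in> X" "dist y x < e" for y
  proof -
    have "B * dist y x \<le> (\<bar>B\<bar> + 1) * dist y x"
      by (intro mult_right_mono) auto
    with B that show ?thesis by (meson order_trans)
  qed
  moreover have "0 < \<bar>B\<bar> + 1" by simp
  ultimately show ?thesis using \<open>0 < e\<close> by blast
qed

lemma pointwise_lipschitz_on_subset: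
  "pointwise_lipschitz_on X f \<Longrightarrow> Y \<subseteq> X \<Longrightarrow> pointwise_lipschitz_on Y f"
  unfolding pointwise_lipschitz_on_def by (meson subsetD)

lemma pointwise_lipschitz_on_global:
  assumes "\<And>x y. x \<in> X \<Longrightarrow> y \<in> X \<Longrightarrow> dist (f y) (f x) \<le> B * dist y x"
  shows "pointwise_lipschitz_on X f"
  unfolding pointwise_lipschitz_on_def using assms zero_less_one by meson

lemma pointwise_lipschitz_on_const: "pointwise_lipschitz_on X (\<lambda>x. c)"
  by (rule pointwise_lipschitz_on_global[where B = 0]) auto

lemma pointwise_lipschitz_on_bounded_linear:
  assumes "bounded_linear f"
  shows "pointwise_lipschitz_on X f"
proof -
  obtain K where "\<And>x. norm (f x) \<le> norm x * K"
    using bounded_linear.bounded[OF assms] by blast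
  then show ?thesis
    by (intro pointwise_lipschitz_on_global[where B = K])
      (simp add: dist_norm mult.commute flip: linear_diff[OF bounded_linear.linear[OF assms]])
qed

lemma pointwise_lipschitz_on_imp_continuous_on:
  assumes "pointwise_lipschitz_on X f"
  shows "continuous_on X f"
  unfolding continuous_on_iff
proof (intro ballI allI impI)
  fix x and r :: real assume "x \<in> X" "0 < r"
  obtain B e where B: "0 < B" "0 < e" "\<And>y. y \<in> X \<Longrightarrow> dist y x < e \<Longrightarrow> dist (f y) (f x) \<le> B * dist y x"
    using pointwise_lipschitz_onD[OF assms \<open>x \<in> X\<close>] by blast
  have "dist (f y) (f x) < r" if "y \<in> X" "dist y x < min e (r / B)" for y
  proof -
    have "B * dist y x < r"
      using that \<open>0 < B\<close> by (simp add: field_simps)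
    with B(3)[of y] that show ?thesis by simp
  qed
  with B \<open>0 < r\<close> show "\<exists>d>0. \<forall>y\<in>X. dist y x < d \<longrightarrow> dist (f y) (f x) < r"
    by (intro exI[of _ "min e (r / B)"]) auto
qed

lemma pointwise_lipschitz_on_compose:
  assumes f: "pointwise_lipschitz_on X f" and g: "pointwise_lipschitz_on Y g" and sub: "f ` X \<subseteq> Y"
  shows "pointwise_lipschitz_on X (\<lambda>x. g (f x))"
  unfolding pointwise_lipschitz_on_def
proof
  fix x assume x: "x \<in> X"
  obtain B e where B: "0 < B" "0 < e" "\<And>y. y \<in> X \<Longrightarrow> dist y x < e \<Longrightarrow> dist (f y) (f x) \<le> B * dist y x"
    using pointwise_lipschitz_onD[OF f x] by blast
  obtain C d where C: "0 < C" "0 < d"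
    "\<And>y. y \<in> Y \<Longrightarrow> dist y (f x) < d \<Longrightarrow> dist (g y) (g (f x)) \<le> C * dist y (f x)"
    using pointwise_lipschitz_onD[OF g, of "f x"] x sub by blast
  have "dist (g (f y)) (g (f x)) \<le> (C * B) * dist y x" if "y \<in> X" "dist y x < min e (d / B)" for y
  proof -
    have le: "dist (f y) (f x) \<le> B * dist y x" using B(3) that by simp
    have "B * dist y x < d" using that B(1) by (simp add: field_simps)
    then have "dist (g (f y)) (g (f x)) \<le> C * dist (f y) (f x)"
      using le that sub by (intro C(3)) auto
    also have "\<dots> \<le> C * (B * dist y x)" using le C(1) by simp
    finally show ?thesis by simp
  qed
  with B C show "\<exists>B. \<exists>e>0. \<forall>y\<in>X. dist y x < e \<longrightarrow> dist (g (f y)) (g (f x)) \<le> B * dist y x"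
    by (intro exI[of _ "C * B"] exI[of _ "min e (d / B)"]) auto
qed

lemma pointwise_lipschitz_on_add:
  fixes f g :: "'a::metric_space \<Rightarrow> 'b::real_normed_vector"
  assumes f: "pointwise_lipschitz_on X f" and g: "pointwise_lipschitz_on X g"
  shows "pointwise_lipschitz_on X (\<lambda>x. f x + g x)"
  unfolding pointwise_lipschitz_on_def
proof
  fix x assume x: "x \<in> X"
  obtain B e where B: "0 < B" "0 < e" "\<And>y. y \<in> X \<Longrightarrow> dist y x < e \<Longrightarrow> dist (f y) (f x) \<le> B * dist y x"
    using pointwise_lipschitz_onD[OF f x] by blast
  obtain C d where C: "0 < C" "0 < d" "\<And>y. y \<in> X \<Longrightarrow> dist y x < d \<Longrightarrow> dist (g y) (g x) \<le> C * dist y x"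
    using pointwise_lipschitz_onD[OF g x] by blast
  have "dist (f y + g y) (f x + g x) \<le> (B + C) * dist y x" if "y \<in> X" "dist y x < min e d" for y
    using B(3)[of y] C(3)[of y] that dist_triangle_add[of "f y" "g y" "f x" "g x"]
    by (simp add: distrib_right)
  with B C show "\<exists>B. \<exists>e>0. \<forall>y\<in>X. dist y x < e \<longrightarrow> dist (f y + g y) (f x + g x) \<le> B * dist y x"
    by (intro exI[of _ "B + C"] exI[of _ "min e d"]) auto
qed

lemma pointwise_lipschitz_on_sum:
  fixes f :: "'i \<Rightarrow> 'a::metric_space \<Rightarrow> 'b::real_normed_vector"
  assumes "\<And>i. i \<in> I \<Longrightarrow> pointwise_lipschitz_on X (f i)"
  shows "pointwise_lipschitz_on X (\<lambda>x. \<Sum>i\<in>I. f i x)"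
  using assms
  by (induction I rule: infinite_finite_induct)
    (simp_all add: pointwise_lipschitz_on_const pointwise_lipschitz_on_add)

lemma pointwise_lipschitz_on_divide:
  fixes f g :: "'a::metric_space \<Rightarrow> real"
  assumes f: "pointwise_lipschitz_on X f" and g: "pointwise_lipschitz_on X g"
    and pos: "\<And>x. x \<in> X \<Longrightarrow> 0 < g x"
  shows "pointwise_lipschitz_on X (\<lambda>x. f x / g x)"
  unfolding pointwise_lipschitz_on_def
proof
  fix x assume x: "x \<in> X"
  obtain B e where B: "0 < B" "0 < e" "\<And>y. y \<in> X \<Longrightarrow> dist y x < e \<Longrightarrow> dist (f y) (f x) \<le> B * dist y x"
    using pointwise_lipschitz_onD[OF f x] by blast
  obtain C d where C: "0 < C" "0 < d" "\<And>y. y \<in> X \<Longrightarrow> dist y x < d \<Longrightarrow> dist (g y) (g x) \<le> C * dist y x"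
    using pointwise_lipschitz_onD[OF g x] by blast
  define s where "s = g x"
  have s: "0 < s" using pos x by (simp add: s_def)
  define K where "K = (s * B + \<bar>f x\<bar> * C) / (s * (s / 2))"
  define r where "r = min e (min d (s / (2 * C)))"
  have "dist (f y / g y) (f x / g x) \<le> K * dist y x" if y: "y \<in> X" "dist y x < r" for y
  proof -
    have fy: "\<bar>f y - f x\<bar> \<le> B * dist y x" and gy: "\<bar>g y - s\<bar> \<le> C * dist y x"
      using B(3)[of y] C(3)[of y] y by (auto simp: r_def dist_real_def s_def)
    have "C * dist y x < s / 2" using y C(1) by (simp add: r_def field_simps)
    then have gs: "s / 2 < g y" using gy by linarith
    have "f y / g y - f x / s = (s * (f y - f x) - f x * (g y - s)) / (s * g y)"
      using s gs by (simp add: field_simps)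
    then have "dist (f y / g y) (f x / g x) = \<bar>s * (f y - f x) - f x * (g y - s)\<bar> / (s * g y)"
      using s gs by (simp add: dist_real_def s_def abs_mult)
    also have "\<dots> \<le> (s * (B * dist y x) + \<bar>f x\<bar> * (C * dist y x)) / (s * (s / 2))"
    proof (rule frac_le)
      show "\<bar>s * (f y - f x) - f x * (g y - s)\<bar> \<le> s * (B * dist y x) + \<bar>f x\<bar> * (C * dist y x)"
      proof -
        have "\<bar>s * (f y - f x) - f x * (g y - s)\<bar> \<le> \<bar>s * (f y - f x)\<bar> + \<bar>f x * (g y - s)\<bar>" by linarith
        also have "\<dots> = s * \<bar>f y - f x\<bar> + \<bar>f x\<bar> * \<bar>g y - s\<bar>" using s by (simp add: abs_mult)
        also have "\<dots> \<le> s * (B * dist y x) + \<bar>f x\<bar> * (C * dist y x)"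
          using fy gy s by (intro add_mono mult_left_mono) auto
        finally show ?thesis .
      qed
      show "s * (s / 2) \<le> s * g y" using s gs by (intro mult_left_mono) auto
    qed (use s B C in auto)
    also have "\<dots> = K * dist y x" by (simp add: K_def field_simps)
    finally show ?thesis .
  qed
  moreover have "0 < r" using B C s by (simp add: r_def)
  ultimately show "\<exists>B. \<exists>e>0. \<forall>y\<in>X. dist y x < e \<longrightarrow> dist (f y / g y) (f x / g x) \<le> B * dist y x"
    by blast
qed

lemma negligible_pointwise_lipschitz_image:
  fixes f :: "'a::euclidean_space \<Rightarrow> 'b::euclidean_space"
  assumes "DIM('a) \<le> DIM('b)" "negligible S" and f: "pointwise_lipschitz_on S f"
  shows "negligible (f ` S)"
proof (rule negligible_locally_Lipschitz_image[OF assms(1,2)])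
  fix x assume "x \<in> S"
  then obtain B e where "0 < e" "\<forall>y\<in>S. dist y x < e \<longrightarrow> dist (f y) (f x) \<le> B * dist y x"
    using pointwise_lipschitz_onD[OF f] by blast
  then show "\<exists>T B. open T \<and> x \<in> T \<and> (\<forall>y \<in> S \<inter> T. norm (f y - f x) \<le> B * norm (y - x))"
    by (intro exI[of _ "ball x e"] exI[of _ B]) (auto simp: dist_norm norm_minus_commute)
qed

text \<open>
  The distances to the complements of the members, divided by their sum. A member that is all of
  \<open>X\<close> has an empty complement; there the constant \<open>1\<close> takes the place of the distance.
\<close>

lemma lipschitz_partition_of_unity:
  fixes X :: "'a::metric_space set"
  assumes "finite \<U>" and op: "\<And>U. U \<in> \<U> \<Longrightarrow> openin (top_of_set X) U" and cov: "X \<subseteq> \<Union>\<U>"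
  obtains \<phi> :: "'a set \<Rightarrow> 'a \<Rightarrow> real" where
    "\<And>U. U \<in> \<U> \<Longrightarrow> pointwise_lipschitz_on X (\<phi> U)"
    "\<And>U x. U \<in> \<U> \<Longrightarrow> x \<in> X \<Longrightarrow> 0 \<le> \<phi> U x"
    "\<And>U x. U \<in> \<U> \<Longrightarrow> x \<in> X \<Longrightarrow> 0 < \<phi> U x \<longleftrightarrow> x \<in> U"
    "\<And>x. x \<in> X \<Longrightarrow> (\<Sum>U\<in>\<U>. \<phi> U x) = 1"
proof -
  define d where "d U x = (if X \<subseteq> U then 1 else infdist x (X - U))" for U x
  define \<phi> where "\<phi> U x = d U x / (\<Sum>V\<in>\<U>. d V x)" for U x
  have d0: "0 \<le> d U x" for U x by (simp add: d_def infdist_nonneg)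
  have dpos: "0 < d U x \<longleftrightarrow> x \<in> U" if U: "U \<in> \<U>" and x: "x \<in> X" for U x
  proof (cases "X \<subseteq> U")
    case False
    have "closedin (top_of_set X) (X - U)" using op[OF U] by (simp add: openin_closedin_eq)
    then obtain C where C: "closed C" "X - U = X \<inter> C" by (auto simp: closedin_closed)
    have "closure (X - U) \<subseteq> C" using C by (metis Int_lower2 closure_minimal)
    then have "x \<notin> closure (X - U)" if "x \<in> U" using that C x by blast
    moreover have "x \<in> closure (X - U)" if "x \<notin> U" using that x closure_subset by blast
    moreover have "X - U \<noteq> {}" using False by blast
    ultimately show ?thesis
      using False infdist_nonneg[of x "X - U"] in_closure_iff_infdist_zero[of "X - U" x]
      by (auto simp: d_def less_le)
  qed (use x in \<open>auto simp: d_def\<close>)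
  have sum_pos: "0 < (\<Sum>V\<in>\<U>. d V x)" if x: "x \<in> X" for x
  proof -
    obtain U where "U \<in> \<U>" "x \<in> U" using cov x by blast
    then show ?thesis
      using dpos[of U x] x d0 \<open>finite \<U>\<close> by (intro sum_pos2[of _ U]) auto
  qed
  have lip: "pointwise_lipschitz_on X (d U)" for U
    by (rule pointwise_lipschitz_on_global[where B = 1])
      (auto simp: d_def dist_real_def infdist_triangle_abs)
  show thesis
  proof
    show "pointwise_lipschitz_on X (\<phi> U)" for U
      unfolding \<phi>_def by (intro pointwise_lipschitz_on_divide pointwise_lipschitz_on_sum lip sum_pos)
    show "0 \<le> \<phi> U x" for U x using d0 by (simp add: \<phi>_def sum_nonneg)
    show "0 < \<phi> U x \<longleftrightarrow> x \<in> U" if "U \<in> \<U>" "x \<in> X" for U x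
      using dpos[OF that] sum_pos[OF that(2)] by (simp add: \<phi>_def zero_less_divide_iff)
    show "(\<Sum>U\<in>\<U>. \<phi> U x) = 1" if "x \<in> X" for x
      using sum_pos[OF that] by (simp add: \<phi>_def flip: sum_divide_distrib)
  qed
qed

section \<open>Covering dimension is at least that of an embedded ball\<close>

lemma covering_dim_le_mono: "covering_dim_le X m \<Longrightarrow> m \<le> n \<Longrightarrow> covering_dim_le X n"
  unfolding covering_dim_le_def by (meson add_right_mono order_trans)

lemma covering_dim_leD:
  assumes "covering_dim_le X n" "finite_open_cover X \<U>"
  shows "\<exists>\<V>. finite_open_cover X \<V> \<and> (\<forall>V\<in>\<V>. \<exists>U\<in>\<U>. V \<subseteq> U) \<and>
    (\<forall>x. int (card {V \<in> \<V>. x \<in> V}) \<le> n + 1)"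
  using assms unfolding covering_dim_le_def by blast

lemma covering_dim_eqI:
  assumes "covering_dim_le X n" "\<not> covering_dim_le X (n - 1)"
  shows "covering_dim X = ereal (real_of_int n)"
  unfolding covering_dim_def
proof (rule antisym)
  show "Inf {ereal (real_of_int n) |n. covering_dim_le X n} \<le> ereal (real_of_int n)"
    using assms(1) by (intro Inf_lower) blast
  have "n \<le> m" if "covering_dim_le X m" for m
    using covering_dim_le_mono[OF that, of "n - 1"] assms(2) by force
  then show "ereal (real_of_int n) \<le> Inf {ereal (real_of_int n) |n. covering_dim_le X n}"
    by (intro Inf_greatest) auto
qed

lemma covering_dim_empty: "covering_dim (top_of_set {}) = -1"
proof -
  have "covering_dim_le (top_of_set {}) (- 1)"
    unfolding covering_dim_le_def finite_open_cover_def by (auto intro!: exI[of _ "{}"])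
  moreover have "\<not> covering_dim_le (top_of_set {}) (- 1 - 1)"
    by (simp add: covering_dim_le_def)
  ultimately show ?thesis
    using covering_dim_eqI[of _ "-1"] by (simp add: one_ereal_def)
qed

lemma not_covering_dim_le_minus_one:
  assumes "topspace X \<noteq> {}"
  shows "\<not> covering_dim_le X (- 1)"
proof
  assume *: "covering_dim_le X (- 1)"
  have "finite_open_cover X {topspace X}" by (simp add: finite_open_cover_def)
  from covering_dim_leD[OF * this] obtain \<V>
    where \<V>: "finite_open_cover X \<V>" "\<forall>x. int (card {V \<in> \<V>. x \<in> V}) \<le> - 1 + 1"
    by (elim exE conjE)
  obtain x where "x \<in> topspace X" using assms by blast
  then obtain V where "V \<in> \<V>" "x \<in> V" using \<V>(1) by (auto simp: finite_open_cover_def)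
  moreover have "finite {V \<in> \<V>. x \<in> V}" using \<V>(1) by (simp add: finite_open_cover_def)
  ultimately show False using \<V>(2)[rule_format, of x] by (auto simp: card_eq_0_iff)
qed

text \<open>
  The image of the compact set is closed in \<open>X\<close>, so a cover of it can be extended to \<open>X\<close>, refined
  there, and pulled back.
\<close>

lemma covering_dim_le_compact_embedding:
  fixes e :: "'a::t2_space \<Rightarrow> 'b::t2_space"
  assumes dim: "covering_dim_le (top_of_set X) n"
    and D: "compact D" "D \<noteq> {}"
    and e: "continuous_on D e" "inj_on e D" "e ` D \<subseteq> X"
  shows "covering_dim_le (top_of_set D) n"
  unfolding covering_dim_le_def
proof (intro conjI allI impI)
  show "- 1 \<le> n" using dim by (simp add: covering_dim_le_def)
  fix \<U> assume \<U>: "finite_open_cover (top_of_set D) \<U>"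
  have fin: "finite \<U>" and op: "\<And>U. U \<in> \<U> \<Longrightarrow> openin (top_of_set D) U" and cov: "\<Union>\<U> = D"
    using \<U> by (auto simp: finite_open_cover_def)
  \<comment> \<open>The image of the complement of \<open>U\<close> is compact, so its complement in \<open>X\<close> is an open set
    whose preimage is exactly \<open>U\<close>.\<close>
  define h where "h U = X - e ` (D - U)" for U
  have "openin (top_of_set X) (h U)" if U: "U \<in> \<U>" for U
  proof -
    have "closedin (top_of_set D) (D - U)" using openin_closedin_eq[of "top_of_set D" U] op[OF U] by simp
    then have "compact (D - U)" by (rule closedin_compact[OF D(1)])
    then have "compact (e ` (D - U))"
      by (meson Diff_subset compact_continuous_image continuous_on_subset e(1))
    then have "closedin (top_of_set X) (e ` (D - U))"
      using e(3) by (intro closed_subset compact_imp_closed) auto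
    then show ?thesis unfolding h_def by (intro openin_diff openin_subtopology_self)
  qed
  moreover have "\<Union>(h ` \<U>) = X"
  proof
    show "X \<subseteq> \<Union>(h ` \<U>)"
    proof
      fix x assume x: "x \<in> X"
      show "x \<in> \<Union>(h ` \<U>)"
      proof (cases "x \<in> e ` D")
        case True
        then obtain d U where "d \<in> D" "x = e d" "U \<in> \<U>" "d \<in> U" using cov by blast
        then have "x \<in> h U" using x e(2) by (auto simp: h_def inj_on_def)
        then show ?thesis using \<open>U \<in> \<U>\<close> by blast
      next
        case False
        obtain U where "U \<in> \<U>" using cov D(2) by blast
        then show ?thesis using x False by (auto simp: h_def)
      qed
    qed
  qed (auto simp: h_def)
  ultimately have "finite_open_cover (top_of_set X) (h ` \<U>)"
    using fin by (auto simp: finite_open_cover_def)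
  from covering_dim_leD[OF dim this] obtain \<V> where \<V>: "finite_open_cover (top_of_set X) \<V>"
    and ref: "\<forall>V\<in>\<V>. \<exists>W\<in>h ` \<U>. V \<subseteq> W" and ord: "\<forall>x. int (card {V \<in> \<V>. x \<in> V}) \<le> n + 1"
    by (elim exE conjE)
  have finV: "finite \<V>" and opV: "\<And>V. V \<in> \<V> \<Longrightarrow> openin (top_of_set X) V" and covV: "\<Union>\<V> = X"
    using \<V> by (auto simp: finite_open_cover_def)
  define g where "g V = D \<inter> e -` V" for V
  have "openin (top_of_set D) (g V)" if "V \<in> \<V>" for V
    unfolding g_def using continuous_openin_preimage[OF e(1) _ opV[OF that]] e(3) by blast
  moreover have "\<Union>(g ` \<V>) = D" using covV e(3) by (auto simp: g_def)
  ultimately have "finite_open_cover (top_of_set D) (g ` \<V>)"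
    using finV by (auto simp: finite_open_cover_def)
  moreover have "\<exists>U\<in>\<U>. V' \<subseteq> U" if V': "V' \<in> g ` \<V>" for V'
  proof -
    obtain V where V: "V \<in> \<V>" "V' = g V" using V' by blast
    then obtain U where "U \<in> \<U>" "V \<subseteq> h U" using ref by blast
    then show ?thesis using V by (auto simp: g_def h_def)
  qed
  moreover have "int (card {V' \<in> g ` \<V>. x \<in> V'}) \<le> n + 1" for x
  proof -
    have "{V' \<in> g ` \<V>. x \<in> V'} \<subseteq> g ` {V \<in> \<V>. e x \<in> V}" by (auto simp: g_def)
    then have "card {V' \<in> g ` \<V>. x \<in> V'} \<le> card {V \<in> \<V>. e x \<in> V}"
      using finV by (intro order_trans[OF card_mono card_image_le]) auto
    then show ?thesis using ord[rule_format, of "e x"] by linarith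
  qed
  ultimately show "\<exists>\<V>. finite_open_cover (top_of_set D) \<V> \<and> (\<forall>V\<in>\<V>. \<exists>U\<in>\<U>. V \<subseteq> U) \<and>
      (\<forall>x. int (card {V \<in> \<V>. x \<in> V}) \<le> n + 1)"
    by blast
qed

text \<open>
  Suppose that a fine cover has a refinement of order less than the dimension. A partition of unity
  then gives a map \<open>g\<close> that moves points only a little and sends each point into the convex hull of
  at most \<open>DIM('a)\<close> of finitely many chosen points. Such hulls are null sets, so \<open>g\<close> misses some
  point \<open>y\<close> near the centre; but by Brouwer's theorem a map so close to the identity hits \<open>y\<close>.
\<close>

lemma not_covering_dim_le_cball:
  "\<not> covering_dim_le (top_of_set (cball (0::'a::euclidean_space) 1)) (int DIM('a) - 1)"
proof
  define D where "D = cball (0::'a) 1"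
  assume dim: "covering_dim_le (top_of_set (cball (0::'a) 1)) (int DIM('a) - 1)"
  have "compact D" by (simp add: D_def)
  then obtain C where C: "finite C" "D \<subseteq> (\<Union>c\<in>C. ball c (1/4))"
    using compactE_image[of D UNIV "\<lambda>c. ball c (1/4)"] by (metis UN_I UNIV_I centre_in_ball open_ball subsetI zero_less_divide_1_iff zero_less_numeral)
  define \<U> where "\<U> = (\<lambda>c. D \<inter> ball c (1/4)) ` C"
  have "finite_open_cover (top_of_set D) \<U>"
    using C by (auto simp: finite_open_cover_def \<U>_def)
  from covering_dim_leD[OF dim[folded D_def] this] obtain \<V> where \<V>: "finite_open_cover (top_of_set D) \<V>"
    and ref: "\<forall>V\<in>\<V>. \<exists>U\<in>\<U>. V \<subseteq> U"
    and ord': "\<forall>x. int (card {V \<in> \<V>. x \<in> V}) \<le> int DIM('a) - 1 + 1"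
    by (elim exE conjE)
  have ord: "card {V \<in> \<V>. x \<in> V} \<le> DIM('a)" for x
    using ord'[rule_format, of x] by simp
  have fin: "finite \<V>" and op: "\<And>V. V \<in> \<V> \<Longrightarrow> openin (top_of_set D) V" and cov: "\<Union>\<V> = D"
    using \<V> by (auto simp: finite_open_cover_def)
  obtain \<phi> :: "'a set \<Rightarrow> 'a \<Rightarrow> real" where
    lip: "\<And>V. V \<in> \<V> \<Longrightarrow> pointwise_lipschitz_on D (\<phi> V)"
    and nonneg: "\<And>V x. V \<in> \<V> \<Longrightarrow> x \<in> D \<Longrightarrow> 0 \<le> \<phi> V x"
    and pos: "\<And>V x. V \<in> \<V> \<Longrightarrow> x \<in> D \<Longrightarrow> 0 < \<phi> V x \<longleftrightarrow> x \<in> V"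
    and one: "\<And>x. x \<in> D \<Longrightarrow> (\<Sum>V\<in>\<V>. \<phi> V x) = 1"
    using lipschitz_partition_of_unity[OF fin op] cov by (metis order_refl)
  define p :: "'a set \<Rightarrow> 'a" where "p V = (SOME v. v \<in> V)" for V
  have near: "dist (p V) x < 1/2" if V: "V \<in> \<V>" "x \<in> V" for V x
  proof -
    obtain c where "V \<subseteq> ball c (1/4)" using ref V(1) by (auto simp: \<U>_def)
    moreover have "p V \<in> V" unfolding p_def using V(2) by (rule someI)
    ultimately have "dist c (p V) < 1/4" "dist c x < 1/4" using V(2) by auto
    then show ?thesis using dist_triangle[of "p V" x c] by (simp add: dist_commute)
  qed
  define g where "g x = (\<Sum>V\<in>\<V>. \<phi> V x *\<^sub>R p V)" for x
  have hull: "g x \<in> convex hull (p ` {V \<in> \<V>. x \<in> V})" if x: "x \<in> D" for x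
  proof -
    have z: "\<phi> V x = 0" if "V \<in> \<V>" "x \<notin> V" for V using nonneg pos that x by fastforce
    have "(\<Sum>V\<in>{V \<in> \<V>. x \<in> V}. \<phi> V x *\<^sub>R p V) \<in> convex hull (p ` {V \<in> \<V>. x \<in> V})"
    proof (rule convex_sum)
      have "(\<Sum>V\<in>{V \<in> \<V>. x \<in> V}. \<phi> V x) = (\<Sum>V\<in>\<V>. \<phi> V x)"
        using fin z by (intro sum.mono_neutral_left) auto
      then show "(\<Sum>V\<in>{V \<in> \<V>. x \<in> V}. \<phi> V x) = 1" using one[OF x] by simp
    qed (use fin nonneg x in \<open>auto intro: hull_inc\<close>)
    moreover have "(\<Sum>V\<in>{V \<in> \<V>. x \<in> V}. \<phi> V x *\<^sub>R p V) = g x"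
      unfolding g_def using fin z by (intro sum.mono_neutral_left) auto
    ultimately show ?thesis by simp
  qed
  have close: "g x \<in> ball x (1/2)" if "x \<in> D" for x
  proof -
    have "p ` {V \<in> \<V>. x \<in> V} \<subseteq> ball x (1/2)" using near by (auto simp: dist_commute)
    then have "convex hull (p ` {V \<in> \<V>. x \<in> V}) \<subseteq> ball x (1/2)" by (simp add: hull_minimal)
    then show ?thesis using hull[OF that] by blast
  qed
  have cont: "continuous_on D g"
    unfolding g_def
    by (intro continuous_intros pointwise_lipschitz_on_imp_continuous_on lip)
  define M where "M = (\<Union>\<W>\<in>{\<W>. \<W> \<subseteq> \<V> \<and> card \<W> \<le> DIM('a)}. convex hull (p ` \<W>))"
  have "negligible M"
    unfolding M_def
  proof (rule negligible_Union)
    fix T assume "T \<in> (\<lambda>\<W>. convex hull (p ` \<W>)) ` {\<W>. \<W> \<subseteq> \<V> \<and> card \<W> \<le> DIM('a)}"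
    then obtain \<W> where \<W>: "\<W> \<subseteq> \<V>" "card \<W> \<le> DIM('a)" "T = convex hull (p ` \<W>)" by blast
    have "finite \<W>" using \<W>(1) fin finite_subset by blast
    then have "interior T = {}"
      unfolding \<W>(3) using \<W>(2) by (meson card_image_le empty_interior_convex_hull finite_imageI order_trans)
    then show "negligible T" using \<W>(3) by (simp add: negligible_convex_interior)
  qed (use fin in simp)
  then have "\<not> ball (0::'a) (1/2) \<subseteq> M"
    by (metis ball_eq_empty negligible_subset not_le open_ball open_not_negligible zero_less_divide_1_iff zero_less_numeral)
  then obtain y :: 'a where y: "norm y < 1/2" "y \<notin> M" by (auto simp: subset_iff)
  \<comment> \<open>A fixed point of \<open>x \<mapsto> x - g x + y\<close> would be a point with \<open>g x = y\<close>.\<close>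
  have sub: "cball y (1/2) \<subseteq> D" unfolding D_def cball_subset_cball_iff
    using y(1) by simp
  obtain x where "x \<in> cball y (1/2)" "x - g x + y = x"
  proof (rule brouwer[of "cball y (1/2)" "\<lambda>x. x - g x + y"])
    show "continuous_on (cball y (1/2)) (\<lambda>x. x - g x + y)"
      by (intro continuous_intros continuous_on_subset[OF cont sub])
    show "(\<lambda>x. x - g x + y) \<in> cball y (1/2) \<rightarrow> cball y (1/2)"
    proof
      fix x assume "x \<in> cball y (1/2)"
      then have "dist x (g x) < 1/2" using close sub by auto
      then show "x - g x + y \<in> cball y (1/2)" by (simp add: dist_norm norm_minus_commute)
    qed
  qed auto
  then have "x \<in> D" "g x = y" using sub by (auto simp: algebra_simps)
  then have "y \<in> M" using hull[of x] ord[of x]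
    by (auto simp: M_def intro!: exI[of _ "{V \<in> \<V>. x \<in> V}"])
  with y(2) show False ..
qed

lemma not_covering_dim_le_if_embedded_cball:
  fixes e :: "'a::euclidean_space \<Rightarrow> 'b::t2_space"
  assumes "0 < r" and e: "continuous_on (cball 0 r) e" "inj_on e (cball 0 r)" "e ` cball 0 r \<subseteq> X"
  shows "\<not> covering_dim_le (top_of_set X) (int DIM('a) - 1)"
proof
  assume dim: "covering_dim_le (top_of_set X) (int DIM('a) - 1)"
  have im: "(\<lambda>x. r *\<^sub>R x) ` cball (0::'a) 1 = cball 0 r"
    using \<open>0 < r\<close> by (simp add: cball_scale)
  have "covering_dim_le (top_of_set (cball (0::'a) 1)) (int DIM('a) - 1)"
  proof (rule covering_dim_le_compact_embedding[OF dim, where e = "\<lambda>x. e (r *\<^sub>R x)"])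
    show "continuous_on (cball 0 1) (\<lambda>x. e (r *\<^sub>R x))"
      using im by (intro continuous_on_compose2[OF e(1)] continuous_intros) auto
    have "inj_on (e \<circ> (\<lambda>x. r *\<^sub>R x)) (cball 0 1)"
      using \<open>0 < r\<close> e(2) im by (intro comp_inj_on) (auto simp: inj_on_def)
    then show "inj_on (\<lambda>x. e (r *\<^sub>R x)) (cball 0 1)" by (simp add: o_def)
    show "(\<lambda>x. e (r *\<^sub>R x)) ` cball 0 1 \<subseteq> X" using e(3) im by auto
  qed auto
  then show False using not_covering_dim_le_cball by blast
qed

section \<open>Covering dimension is small when Lipschitz images are null\<close>

text \<open>
  The vectors are chosen one after the other: the spans of fewer than \<open>DIM('b)\<close> earlier vectors form
  a null set, so the next vector can avoid them all and still be close to \<open>b\<close>.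
\<close>

lemma exists_general_position_near:
  fixes b :: "'b::euclidean_space"
  assumes "finite \<U>" "0 < r"
  shows "\<exists>v. (\<forall>U\<in>\<U>. dist b (v U) < r) \<and>
    (\<forall>I\<subseteq>\<U>. card I \<le> DIM('b) \<longrightarrow> inj_on v I \<and> independent (v ` I))"
  using assms(1)
proof induction
  case empty
  then show ?case by (simp add: independent_empty)
next
  case (insert u F)
  then obtain v where near: "\<forall>U\<in>F. dist b (v U) < r"
    and gen: "\<forall>I\<subseteq>F. card I \<le> DIM('b) \<longrightarrow> inj_on v I \<and> independent (v ` I)" by blast
  define N where "N = (\<Union>I\<in>{I. I \<subseteq> F \<and> card I < DIM('b)}. span (v ` I))"
  have "negligible N"
    unfolding N_def
  proof (rule negligible_Union)
    fix T assume "T \<in> (\<lambda>I. span (v ` I)) ` {I. I \<subseteq> F \<and> card I < DIM('b)}"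
    then obtain I where I: "I \<subseteq> F" "card I < DIM('b)" "T = span (v ` I)" by blast
    have "finite I" using I(1) insert.hyps(1) finite_subset by blast
    then have "dim T < DIM('b)"
      unfolding I(3) dim_span using I(2) dim_le_card'[of "v ` I"] card_image_le[of I v] by simp
    then show "negligible T" by (rule negligible_lowdim)
  qed (use insert.hyps(1) in simp)
  then have "\<not> ball b r \<subseteq> N"
    using \<open>0 < r\<close> by (metis ball_eq_empty negligible_subset not_le open_ball open_not_negligible)
  then obtain w where w: "dist b w < r" "w \<notin> N" by (metis mem_ball subsetI)
  define v' where "v' = v(u := w)"
  have eq: "v' ` I = v ` I" "inj_on v' I = inj_on v I" if "I \<subseteq> F" for I
    using insert.hyps(2) that unfolding v'_def
    by (intro image_cong inj_on_cong; fastforce)+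
  have "inj_on v' I \<and> independent (v' ` I)" if I: "I \<subseteq> insert u F" "card I \<le> DIM('b)" for I
  proof (cases "u \<in> I")
    case False
    then have "I \<subseteq> F" using I(1) by blast
    then show ?thesis using gen I(2) eq by auto
  next
    case True
    define K where "K = I - {u}"
    have K: "I = insert u K" "u \<notin> K" "K \<subseteq> F" using True I(1) by (auto simp: K_def)
    moreover have "finite K" using K(3) insert.hyps(1) finite_subset by blast
    ultimately have card: "card K < DIM('b)" using I(2) by simp
    then have "w \<notin> span (v ` K)" using w(2) K(3) by (auto simp: N_def)
    moreover from this have "w \<notin> v ` K" using span_base[of w "v ` K"] by metis
    moreover have "inj_on v K" "independent (v ` K)" using gen K(3) card by auto
    moreover have "v' u = w" by (simp add: v'_def)
    ultimately show ?thesis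
      unfolding K(1) image_insert inj_on_insert using K(2) eq[OF K(3)] by (simp add: independent_insertI)
  qed
  moreover have "\<forall>U\<in>insert u F. dist b (v' U) < r" using near w(1) by (simp add: v'_def)
  ultimately show ?case by blast
qed

lemma openin_finite_conj:
  assumes "finite I" "\<And>i. i \<in> I \<Longrightarrow> openin X {x \<in> topspace X. P i x}"
  shows "openin X {x \<in> topspace X. \<forall>i\<in>I. P i x}"
  using assms
proof (induction I)
  case (insert i I)
  have "{x \<in> topspace X. \<forall>i\<in>insert i I. P i x} =
      {x \<in> topspace X. P i x} \<inter> {x \<in> topspace X. \<forall>i\<in>I. P i x}" by auto
  then show ?case using insert by (simp add: openin_Int)
qed simp

lemma openin_Collect_less_continuous_on:
  fixes f g :: "'a::topological_space \<Rightarrow> real"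
  assumes "continuous_on X f" "continuous_on X g"
  shows "openin (top_of_set X) {x \<in> X. f x < g x}"
proof -
  have "openin (top_of_set X) (X \<inter> (\<lambda>x. g x - f x) -` {0<..})"
    by (intro continuous_openin_preimage_gen continuous_intros assms open_greaterThan)
  then show ?thesis by (simp add: vimage_def Int_def)
qed

text \<open>
  Since the \<open>v i\<close> form a basis, \<open>s\<close> is determined by the numbers \<open>s \<bullet> v i\<close>. The set is therefore
  contained in the image of \<open>X\<close> under \<open>x \<mapsto> T'(\<Sum>i. \<phi> i x *\<^sub>R v i)\<close>, where \<open>T'\<close> inverts the linear map
  \<open>s \<mapsto> \<Sum>i. (s \<bullet> v i) *\<^sub>R v i\<close>.
\<close>

lemma linear_system_bad_set_negligible:
  fixes v :: "'i \<Rightarrow> 'b::euclidean_space" and \<phi> :: "'i \<Rightarrow> 'a::euclidean_space \<Rightarrow> real"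
  assumes null: "\<And>F::'a \<Rightarrow> 'b. pointwise_lipschitz_on X F \<Longrightarrow> negligible (F ` X)"
    and lip: "\<And>i. i \<in> I \<Longrightarrow> pointwise_lipschitz_on X (\<phi> i)"
    and I: "finite I" "card I = DIM('b)" "inj_on v I" "independent (v ` I)"
  shows "negligible {s. \<exists>x\<in>X. \<forall>i\<in>I. \<phi> i x = s \<bullet> v i}"
proof -
  define T where "T s = (\<Sum>i\<in>I. (s \<bullet> v i) *\<^sub>R v i)" for s
  have lin: "linear T"
    unfolding T_def by (intro linear_compose_sum ballI linearI)
      (auto simp: inner_add_left scaleR_add_left)
  have full: "span (v ` I) = UNIV"
  proof -
    have "dim (v ` I) = DIM('b)"
      using I by (simp add: dim_eq_card_independent card_image)
    then show ?thesis by (simp add: dim_eq_full)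
  qed
  have perp: "s \<bullet> v i = 0" if "T s = 0" "i \<in> I" for s i
  proof -
    have "(\<Sum>i\<in>I. (s \<bullet> v i)\<^sup>2) = s \<bullet> T s"
      by (simp add: T_def inner_sum_right power2_eq_square)
    then show ?thesis using that I(1) by (simp add: sum_nonneg_eq_0_iff)
  qed
  have "s = 0" if s: "T s = 0" for s
  proof -
    have "orthogonal s s"
    proof (rule orthogonal_to_span)
      show "s \<in> span (v ` I)" by (simp add: full)
      show "orthogonal s y" if "y \<in> v ` I" for y
        using that perp[OF s] by (auto simp: orthogonal_def)
    qed
    then show ?thesis by (simp add: orthogonal_self)
  qed
  then have "inj T" using lin by (simp add: linear_injective_0)
  then obtain T' where T': "linear T'" "T' \<circ> T = id"
    using linear_injective_left_inverse[OF lin] by blast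
  define F where "F x = T' (\<Sum>i\<in>I. \<phi> i x *\<^sub>R v i)" for x
  have "pointwise_lipschitz_on X F"
    unfolding F_def
  proof (rule pointwise_lipschitz_on_compose[where Y = UNIV and g = T' and f = "\<lambda>x. \<Sum>i\<in>I. \<phi> i x *\<^sub>R v i"])
    show "pointwise_lipschitz_on X (\<lambda>x. \<Sum>i\<in>I. \<phi> i x *\<^sub>R v i)"
    proof (rule pointwise_lipschitz_on_sum)
      fix i assume "i \<in> I"
      then show "pointwise_lipschitz_on X (\<lambda>x. \<phi> i x *\<^sub>R v i)"
        by (intro pointwise_lipschitz_on_compose[where f = "\<phi> i" and g = "\<lambda>t. t *\<^sub>R v i" and Y = UNIV]
            lip pointwise_lipschitz_on_bounded_linear bounded_linear_scaleR_left) auto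
    qed
    show "pointwise_lipschitz_on UNIV T'"
      using T'(1) by (simp add: pointwise_lipschitz_on_bounded_linear linear_conv_bounded_linear)
  qed auto
  then have "negligible (F ` X)" by (rule null)
  moreover have "{s. \<exists>x\<in>X. \<forall>i\<in>I. \<phi> i x = s \<bullet> v i} \<subseteq> F ` X"
  proof clarify
    fix s x assume x: "x \<in> X" and "\<forall>i\<in>I. \<phi> i x = s \<bullet> v i"
    then have "F x = T' (T s)" by (simp add: F_def T_def)
    then have "F x = s" using fun_cong[OF T'(2), of s] by simp
    then show "s \<in> F ` X" using x by blast
  qed
  ultimately show ?thesis by (rule negligible_subset)
qed

text \<open>
  Take a partition of unity \<open>\<phi>\<close> subordinate to the cover and generic thresholds \<open>t U\<close>, so small that
  each point exceeds at least one of them. Since images in \<open>\<real>\<^sup>d\<^sup>+\<^sup>1\<close> are null, no point lies on \<open>d + 1\<close>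
  of the level sets \<open>\<phi> U = t U\<close>. Sort the points by the set \<open>e\<close> of level sets that contain them and
  by the set \<open>p\<close> of exceeded thresholds. Each piece is contained in a member of the cover, and pieces
  with equally many equalities have disjoint open neighbourhoods, namely the sets where
  \<open>\<bar>\<phi> U - t U\<bar>\<close> is smaller on \<open>e\<close> than off \<open>e\<close> and the signs off \<open>e\<close> are unchanged. As \<open>card e\<close> takes
  only the values \<open>0, \<dots>, d\<close>, at most \<open>d + 1\<close> of these neighbourhoods meet in a point.
\<close>

theorem covering_dim_le_if_lipschitz_images_negligible:
  fixes X :: "'a::euclidean_space set"
  assumes null: "\<And>F::'a \<Rightarrow> 'b::euclidean_space. pointwise_lipschitz_on X F \<Longrightarrow> negligible (F ` X)"
  shows "covering_dim_le (top_of_set X) (int DIM('b) - 1)"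
  unfolding covering_dim_le_def
proof (intro conjI allI impI)
  show "- 1 \<le> int DIM('b) - 1" by simp
  fix \<U> assume \<U>: "finite_open_cover (top_of_set X) \<U>"
  have fin: "finite \<U>" and op: "\<And>U. U \<in> \<U> \<Longrightarrow> openin (top_of_set X) U" and cov: "\<Union>\<U> = X"
    using \<U> by (auto simp: finite_open_cover_def)
  have "X \<subseteq> \<Union>\<U>" using cov by simp
  then obtain \<phi> :: "'a set \<Rightarrow> 'a \<Rightarrow> real" where
    lip: "\<And>U. U \<in> \<U> \<Longrightarrow> pointwise_lipschitz_on X (\<phi> U)"
    and pos: "\<And>U x. U \<in> \<U> \<Longrightarrow> x \<in> X \<Longrightarrow> 0 < \<phi> U x \<longleftrightarrow> x \<in> U"
    and one: "\<And>x. x \<in> X \<Longrightarrow> (\<Sum>U\<in>\<U>. \<phi> U x) = 1"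
    using lipschitz_partition_of_unity[OF fin op] by metis
  \<comment> \<open>The weights sum to \<open>1\<close>, so some weight is at least \<open>1 / card \<U>\<close> and exceeds \<open>1 / m\<close>.\<close>
  define m where "m = real (card \<U>) + 1"
  have m: "1 \<le> m" by (simp add: m_def)
  obtain b :: 'b where b: "norm b = 1" using vector_choose_size[of 1] by auto
  obtain v where near: "\<And>U. U \<in> \<U> \<Longrightarrow> dist b (v U) < 1/4"
    and gen: "\<And>I. I \<subseteq> \<U> \<Longrightarrow> card I \<le> DIM('b) \<Longrightarrow> inj_on v I \<and> independent (v ` I)"
    using exists_general_position_near[OF fin, of "1/4" b] by force
  define bad where "bad = (\<Union>I\<in>{I. I \<subseteq> \<U> \<and> card I = DIM('b)}. {s. \<exists>x\<in>X. \<forall>U\<in>I. \<phi> U x = s \<bullet> v U})"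
  have "negligible bad"
    unfolding bad_def
  proof (rule negligible_Union)
    fix N assume "N \<in> (\<lambda>I. {s. \<exists>x\<in>X. \<forall>U\<in>I. \<phi> U x = s \<bullet> v U}) ` {I. I \<subseteq> \<U> \<and> card I = DIM('b)}"
    then obtain I where I: "I \<subseteq> \<U>" "card I = DIM('b)"
      and N: "N = {s. \<exists>x\<in>X. \<forall>U\<in>I. \<phi> U x = s \<bullet> v U}" by blast
    show "negligible N"
      unfolding N using I gen[OF I(1)] lip fin
      by (intro linear_system_bad_set_negligible null) (auto intro: finite_subset)
  qed (use fin in simp)
  \<comment> \<open>All thresholds are read off from one vector \<open>s\<close> as \<open>s \<bullet> v U\<close>. As the \<open>v U\<close> are close to the unit
    vector \<open>b\<close>, choosing \<open>s\<close> close to \<open>b / (2 m)\<close> keeps them close to \<open>1 / (2 m)\<close>.\<close>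
  define c where "c = b /\<^sub>R (2 * m)"
  have "\<not> ball c (1 / (8 * m)) \<subseteq> bad"
    using \<open>negligible bad\<close> m
    by (metis ball_eq_empty negligible_subset not_le open_ball open_not_negligible zero_less_divide_1_iff
        zero_less_mult_iff zero_less_numeral less_le_trans zero_less_one)
  then obtain s where s: "dist c s < 1 / (8 * m)" "s \<notin> bad" by (metis mem_ball subsetI)
  define t where "t U = s \<bullet> v U" for U
  have t: "0 < t U" "t U < 1 / m" if U: "U \<in> \<U>" for U
  proof -
    have "\<bar>t U - 1 / (2 * m)\<bar> < 1 / (2 * m)"
    proof -
      have "b \<bullet> b = 1" using b by (simp add: norm_eq_1)
      then have cb: "c \<bullet> b = 1 / (2 * m)" unfolding c_def inner_scaleR_left by (simp add: inverse_eq_divide)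
      have "t U - 1 / (2 * m) = (s - c) \<bullet> v U + c \<bullet> (v U - b)"
        using cb by (simp add: t_def inner_diff_left inner_diff_right)
      also have "\<bar>\<dots>\<bar> \<le> norm (s - c) * norm (v U) + norm c * norm (v U - b)"
        by (intro order_trans[OF abs_triangle_ineq] add_mono Cauchy_Schwarz_ineq2)
      also have "\<dots> \<le> 1 / (8 * m) * (5/4) + 1 / (2 * m) * (1/4)"
      proof (intro add_mono mult_mono)
        show "norm (s - c) \<le> 1 / (8 * m)" using s(1) by (simp add: dist_norm norm_minus_commute)
        have "norm (v U) \<le> norm b + norm (v U - b)" by norm
        then show "norm (v U) \<le> 5/4" using near[OF U] b by (simp add: dist_norm norm_minus_commute)
        show "norm c \<le> 1 / (2 * m)" using b m by (simp add: c_def inverse_eq_divide)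
        show "norm (v U - b) \<le> 1/4" using near[OF U] by (simp add: dist_norm norm_minus_commute)
      qed (use m in auto)
      also have "\<dots> < 1 / (2 * m)" using m by (simp add: field_simps)
      finally show ?thesis .
    qed
    moreover have "1 / m = 1 / (2 * m) + 1 / (2 * m)" using m by (simp add: field_simps)
    ultimately show "0 < t U" "t U < 1 / m" by linarith+
  qed
  define E where "E x = {U \<in> \<U>. \<phi> U x = t U}" for x
  define P where "P x = {U \<in> \<U>. t U < \<phi> U x}" for x
  have cardE: "card (E x) < DIM('b)" if "x \<in> X" for x
  proof (rule ccontr)
    assume "\<not> card (E x) < DIM('b)"
    then obtain I where I: "I \<subseteq> E x" "card I = DIM('b)"
      by (metis not_less obtain_subset_with_card_n)
    then have "I \<subseteq> \<U>" "\<forall>U\<in>I. \<phi> U x = s \<bullet> v U" by (auto simp: E_def t_def)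
    then have "s \<in> bad" using I(2) \<open>x \<in> X\<close> by (auto simp: bad_def)
    with s(2) show False ..
  qed
  have P_ne: "P x \<noteq> {}" if "x \<in> X" for x
  proof
    assume "P x = {}"
    then have "\<phi> U x \<le> 1 / m" if "U \<in> \<U>" for U using t[OF that] that by (force simp: P_def)
    then have "(\<Sum>U\<in>\<U>. \<phi> U x) \<le> real (card \<U>) * (1 / m)" by (rule sum_bounded_above)
    also have "\<dots> < 1" by (simp add: m_def field_simps)
    finally show False using one[OF \<open>x \<in> X\<close>] by simp
  qed
  \<comment> \<open>If two index sets \<open>e \<noteq> e'\<close> have equal cardinality, each has an element outside the other, and the
    comparisons of \<open>\<bar>\<phi> U - t U\<bar>\<close> in the two neighbourhoods contradict each other.\<close>
  define W where "W = (\<lambda>(e, p). {x \<in> X. (\<forall>U\<in>p. t U < \<phi> U x) \<and> (\<forall>U\<in>\<U> - e - p. \<phi> U x < t U) \<and>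
      (\<forall>U\<in>e. \<forall>V\<in>\<U> - e. \<bar>\<phi> U x - t U\<bar> < \<bar>\<phi> V x - t V\<bar>)})"
  define K where "K = {(e, p). e \<subseteq> \<U> \<and> p \<subseteq> \<U> - e \<and> card e < DIM('b) \<and> p \<noteq> {}}"
  have "finite K"
    by (rule finite_subset[of _ "Pow \<U> \<times> Pow \<U>"]) (use fin in \<open>auto simp: K_def\<close>)
  have cont: "continuous_on X (\<phi> U)" if "U \<in> \<U>" for U
    by (rule pointwise_lipschitz_on_imp_continuous_on[OF lip[OF that]])
  have openW: "openin (top_of_set X) (W k)" if k: "k \<in> K" for k
  proof -
    obtain e p where k': "k = (e, p)" "e \<subseteq> \<U>" "p \<subseteq> \<U>" using k by (auto simp: K_def)
    have sub: "finite e" "finite p" "finite (\<U> - e - p)" "finite (\<U> - e)"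
      using k' fin finite_subset by auto
    have "openin (top_of_set X) {x \<in> topspace (top_of_set X). \<forall>U\<in>p. t U < \<phi> U x}"
      using sub k' by (intro openin_finite_conj)
        (auto intro!: openin_Collect_less_continuous_on continuous_intros cont)
    moreover have "openin (top_of_set X) {x \<in> topspace (top_of_set X). \<forall>U\<in>\<U> - e - p. \<phi> U x < t U}"
      using sub k' by (intro openin_finite_conj)
        (auto intro!: openin_Collect_less_continuous_on continuous_intros cont)
    moreover have "openin (top_of_set X) {x \<in> topspace (top_of_set X).
        \<forall>U\<in>e. \<forall>V\<in>\<U> - e. \<bar>\<phi> U x - t U\<bar> < \<bar>\<phi> V x - t V\<bar>}"
      using sub k' by (intro openin_finite_conj)
        (auto intro!: openin_Collect_less_continuous_on continuous_intros cont)
    moreover have "W k = {x \<in> topspace (top_of_set X). \<forall>U\<in>p. t U < \<phi> U x} \<inter>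
        {x \<in> topspace (top_of_set X). \<forall>U\<in>\<U> - e - p. \<phi> U x < t U} \<inter>
        {x \<in> topspace (top_of_set X). \<forall>U\<in>e. \<forall>V\<in>\<U> - e. \<bar>\<phi> U x - t U\<bar> < \<bar>\<phi> V x - t V\<bar>}"
      by (auto simp: W_def k'(1))
    ultimately show ?thesis by (simp only: openin_Int)
  qed
  have coverW: "\<exists>k\<in>K. x \<in> W k" if "x \<in> X" for x
  proof (rule bexI[of _ "(E x, P x)"])
    show "(E x, P x) \<in> K" using cardE P_ne that by (auto simp: K_def E_def P_def)
    show "x \<in> W (E x, P x)" using that by (auto simp: W_def E_def P_def)
  qed
  have signs: "p = {U \<in> \<U> - e. t U < \<phi> U x}" if "(e, p) \<in> K" "x \<in> W (e, p)" for e p x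
  proof -
    have sub: "p \<subseteq> \<U> - e" using that(1) by (simp add: K_def)
    have "\<forall>U\<in>p. t U < \<phi> U x" "\<forall>U\<in>\<U> - e - p. \<phi> U x < t U"
      using that(2) by (simp_all add: W_def)
    with sub show ?thesis by (auto dest: less_asym)
  qed
  have disj: "e = e' \<and> p = p'"
    if k: "(e, p) \<in> K" "(e', p') \<in> K" and x: "x \<in> W (e, p)" "x \<in> W (e', p')" and card: "card e = card e'"
    for e p e' p' x
  proof -
    have sub: "e \<subseteq> \<U>" "e' \<subseteq> \<U>" "p \<subseteq> \<U> - e" "p' \<subseteq> \<U> - e'" using k by (auto simp: K_def)
    have "finite e" "finite e'"
      using finite_subset[OF sub(1) fin] finite_subset[OF sub(2) fin] by auto
    have ee: "e = e'"
    proof (rule ccontr)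
      assume "e \<noteq> e'"
      then have "\<not> e \<subseteq> e'" "\<not> e' \<subseteq> e"
        using card card_subset_eq[of e' e] card_subset_eq[of e e'] \<open>finite e\<close> \<open>finite e'\<close> by auto
      then obtain U V where UV: "U \<in> e" "U \<notin> e'" "V \<in> e'" "V \<notin> e" by blast
      then have "\<bar>\<phi> U x - t U\<bar> < \<bar>\<phi> V x - t V\<bar>" "\<bar>\<phi> V x - t V\<bar> < \<bar>\<phi> U x - t U\<bar>"
        using x sub by (auto simp: W_def)
      then show False by simp
    qed
    moreover have "p = {U \<in> \<U> - e. t U < \<phi> U x}" "p' = {U \<in> \<U> - e'. t U < \<phi> U x}"
      using signs k x by auto
    ultimately show ?thesis by simp
  qed
  have "finite_open_cover (top_of_set X) (W ` K)"
    using \<open>finite K\<close> openW coverW by (auto simp: finite_open_cover_def W_def)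
  moreover have "\<exists>U\<in>\<U>. V \<subseteq> U" if V: "V \<in> W ` K" for V
  proof -
    obtain e p where k: "(e, p) \<in> K" "V = W (e, p)" using V by auto
    then obtain U where U: "U \<in> p" "U \<in> \<U>" by (auto simp: K_def)
    have "x \<in> U" if "x \<in> V" for x
    proof -
      have x: "x \<in> X" "t U < \<phi> U x" using that U(1) by (auto simp: k(2) W_def)
      then show ?thesis using t(1)[OF U(2)] pos[OF U(2), of x] by simp
    qed
    then show ?thesis using U(2) by blast
  qed
  moreover have "int (card {V \<in> W ` K. x \<in> V}) \<le> int DIM('b) - 1 + 1" for x
  proof -
    define L where "L = {k \<in> K. x \<in> W k}"
    have "inj_on (\<lambda>k. card (fst k)) L"
      using disj by (fastforce simp: inj_on_def L_def)
    moreover have "(\<lambda>k. card (fst k)) ` L \<subseteq> {..<DIM('b)}" by (auto simp: L_def K_def)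
    ultimately have "card L \<le> DIM('b)" by (metis card_inj_on_le card_lessThan finite_lessThan)
    moreover have "{V \<in> W ` K. x \<in> V} = W ` L" by (auto simp: L_def)
    moreover have "card (W ` L) \<le> card L" using \<open>finite K\<close> by (simp add: L_def card_image_le)
    ultimately show ?thesis by simp
  qed
  ultimately show "\<exists>\<V>. finite_open_cover (top_of_set X) \<V> \<and> (\<forall>V\<in>\<V>. \<exists>U\<in>\<U>. V \<subseteq> U) \<and>
      (\<forall>x. int (card {V \<in> \<V>. x \<in> V}) \<le> int DIM('b) - 1 + 1)"
    by (intro exI[of _ "W ` K"]) blast
qed

section \<open>Dimension of a similarity class\<close>

lemma matrix_mult_add_left: "((A::real^'n^'m) + B) ** (C::real^'p^'n) = A ** C + B ** C"
  by (simp add: vec_eq_iff matrix_matrix_mult_def distrib_right sum.distrib)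

lemma bounded_bilinear_matrix_mult:
  "bounded_bilinear (\<lambda>(A::real^'n^'m) (B::real^'p^'n). A ** B)"
  by (subst bilinear_conv_bounded_bilinear[symmetric])
    (auto simp: bilinear_def intro!: linearI
      simp: matrix_add_ldistrib matrix_mult_add_left matrix_scalar_ac scalar_matrix_assoc)

lemma bounded_bilinear_matrix_vector_mult:
  "bounded_bilinear (\<lambda>(A::real^'n^'m) x. A *v x)"
  by (subst bilinear_conv_bounded_bilinear[symmetric])
    (auto simp: bilinear_def intro!: linearI
      simp: matrix_vector_mult_add_rdistrib algebra_simps scaleR_matrix_vector_assoc)

lemma matrix_mult_scaleR_left: "(k *\<^sub>R (A::real^'n^'m)) ** (C::real^'p^'n) = k *\<^sub>R (A ** C)"
  by (rule bounded_bilinear.scaleR_left[OF bounded_bilinear_matrix_mult])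

lemma matrix_mult_scaleR_right: "(A::real^'n^'m) ** (k *\<^sub>R (C::real^'p^'n)) = k *\<^sub>R (A ** C)"
  by (rule bounded_bilinear.scaleR_right[OF bounded_bilinear_matrix_mult])

lemma matrix_mult_diff_left: "((A::real^'n^'m) - B) ** (C::real^'p^'n) = A ** C - B ** C"
  by (rule bounded_bilinear.diff_left[OF bounded_bilinear_matrix_mult])

lemma matrix_mult_diff_right: "(A::real^'n^'m) ** ((B::real^'p^'n) - C) = A ** B - A ** C"
  by (rule bounded_bilinear.diff_right[OF bounded_bilinear_matrix_mult])

lemma matrix_mult_zero_left [simp]: "(0::real^'n^'m) ** (C::real^'p^'n) = 0"
  by (rule bounded_bilinear.zero_left[OF bounded_bilinear_matrix_mult])

lemma matrix_mult_zero_right [simp]: "(C::real^'n^'m) ** (0::real^'p^'n) = 0"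
  by (rule bounded_bilinear.zero_right[OF bounded_bilinear_matrix_mult])

lemma matrix_mult_norm_bound:
  "\<exists>K\<ge>1. (\<forall>(A::real^'n^'n) (B::real^'n^'n). norm (A ** B) \<le> K * (norm A * norm B)) \<and>
    (\<forall>(A::real^'n^'n) x. norm (A *v x) \<le> K * (norm A * norm x))"
proof -
  obtain K where K: "0 < K" "\<And>(A::real^'n^'n) (B::real^'n^'n). norm (A ** B) \<le> norm A * norm B * K"
    using bounded_bilinear.pos_bounded[OF bounded_bilinear_matrix_mult] by blast
  obtain L where L: "0 < L" "\<And>(A::real^'n^'n) x. norm (A *v x) \<le> norm A * norm x * L"
    using bounded_bilinear.pos_bounded[OF bounded_bilinear_matrix_vector_mult] by blast
  define M where "M = K + L + 1"
  have "norm (A ** B) \<le> M * (norm A * norm B)" for A B :: "real^'n^'n"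
  proof -
    have "norm A * norm B * K \<le> norm A * norm B * M" using L(1) by (intro mult_left_mono) (auto simp: M_def)
    with K(2)[of A B] show ?thesis by (simp add: mult_ac)
  qed
  moreover have "norm (A *v x) \<le> M * (norm A * norm x)" for A :: "real^'n^'n" and x
  proof -
    have "norm A * norm x * L \<le> norm A * norm x * M" using K(1) by (intro mult_left_mono) (auto simp: M_def)
    with L(2)[of A x] show ?thesis by (simp add: mult_ac)
  qed
  moreover have "1 \<le> M" using K(1) L(1) by (simp add: M_def)
  ultimately show ?thesis by blast
qed

lemma matrix_inv_mult:
  assumes "invertible (X::real^'n^'n)"
  shows "X ** matrix_inv X = mat 1" "matrix_inv X ** X = mat 1"
proof -
  have "X ** matrix_inv X = mat 1 \<and> matrix_inv X ** X = mat 1"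
    unfolding matrix_inv_def using assms unfolding invertible_def by (rule someI_ex)
  then show "X ** matrix_inv X = mat 1" "matrix_inv X ** X = mat 1" by auto
qed

text \<open>
  The similarity class for matrices of any size.
\<close>

definition orbit :: "real^'n^'n \<Rightarrow> (real^'n^'n) set" where
  "orbit B = {matrix_inv X ** B ** X | X. invertible X}"

lemma similarity_eq_iff:
  assumes "invertible (X::real^'n^'n)"
  shows "matrix_inv X ** B ** X = Y \<longleftrightarrow> B ** X = X ** Y"
proof
  assume "matrix_inv X ** B ** X = Y"
  then have "X ** Y = (X ** matrix_inv X) ** B ** X" by (metis matrix_mul_assoc)
  then show "B ** X = X ** Y" using matrix_inv_mult[OF assms] by simp
next
  assume "B ** X = X ** Y"
  then have "matrix_inv X ** B ** X = (matrix_inv X ** X) ** Y" by (metis matrix_mul_assoc)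
  then show "matrix_inv X ** B ** X = Y" using matrix_inv_mult[OF assms] by simp
qed

definition centralizer :: "real^'n^'n \<Rightarrow> (real^'n^'n) set" where
  "centralizer B = {Z. Z ** B = B ** Z}"

lemma similarity_centralizer_mult:
  assumes "invertible (X::real^'n^'n)" "invertible Z" "Z \<in> centralizer B"
  shows "matrix_inv (Z ** X) ** B ** (Z ** X) = matrix_inv X ** B ** X"
proof -
  have "B ** X = X ** (matrix_inv X ** B ** X)" using similarity_eq_iff[OF assms(1)] by blast
  moreover have "B ** (Z ** X) = Z ** (B ** X)" using assms(3) by (simp add: centralizer_def matrix_mul_assoc)
  ultimately have "B ** (Z ** X) = (Z ** X) ** (matrix_inv X ** B ** X)" by (metis matrix_mul_assoc)
  then show ?thesis using similarity_eq_iff[OF invertible_mult[OF assms(2,1)]] by blast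
qed

lemma self_in_orbit: "A \<in> orbit A"
  unfolding orbit_def
  by (rule CollectI, rule exI[of _ "mat 1"])
    (metis invertible_def matrix_inv_mult(2) matrix_mul_lid matrix_mul_rid)

lemma sim_class_eq_orbit: "sim_class B = orbit B"
  by (simp add: sim_class_def orbit_def)

lemma subspace_centralizer: "subspace (centralizer B)"
  by (auto simp: subspace_def centralizer_def matrix_add_ldistrib matrix_mult_add_left
      matrix_scalar_ac simp flip: scalar_matrix_assoc)

lemma mat_1_in_centralizer: "mat 1 \<in> centralizer B"
  by (simp add: centralizer_def)

lemma invertible_near_mat_1:
  fixes X :: "real^'n^'n"
  assumes K: "\<And>(A::real^'n^'n) x. norm (A *v x) \<le> K * (norm A * norm x)"
    and X: "K * norm (X - mat 1) < 1"
  shows "invertible X"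
proof -
  have "v = 0" if v: "X *v v = 0" for v
  proof (rule ccontr)
    assume "v \<noteq> 0"
    have "norm v = norm ((X - mat 1) *v v)"
      using v by (simp add: matrix_vector_mult_diff_rdistrib)
    also have "\<dots> \<le> (K * norm (X - mat 1)) * norm v" using K by (simp add: mult.assoc)
    also have "\<dots> < 1 * norm v" using X \<open>v \<noteq> 0\<close> by (intro mult_strict_right_mono) auto
    finally show False by simp
  qed
  then show ?thesis by (simp add: invertible_left_inverse matrix_left_invertible_ker)
qed

text \<open>
  With \<open>D = Y\<^sup>-\<^sup>1 B Y - X\<^sup>-\<^sup>1 B X\<close> one has \<open>Y D = B (Y - X) - (Y - X) X\<^sup>-\<^sup>1 B X\<close>, and multiplication by an
  invertible \<open>X\<close>, hence by any \<open>Y\<close> near it, is bounded below. In this way no estimate for the inverse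
  of \<open>Y\<close> is needed.
\<close>

lemma pointwise_lipschitz_on_similarity:
  fixes B :: "real^'n^'n"
  shows "pointwise_lipschitz_on {X::real^'n^'n. invertible X} (\<lambda>X. matrix_inv X ** B ** X)"
  unfolding pointwise_lipschitz_on_def
proof
  fix X :: "real^'n^'n" assume "X \<in> {X. invertible X}"
  then have X: "invertible X" by simp
  obtain K where K: "1 \<le> K" "\<And>(A::real^'n^'n) (B::real^'n^'n). norm (A ** B) \<le> K * (norm A * norm B)"
    using matrix_mult_norm_bound by blast
  let ?f = "\<lambda>X. matrix_inv X ** B ** X"
  define L where "L = K * norm (matrix_inv X) + 1"
  have L: "1 \<le> L" using K(1) by (simp add: L_def)
  have below: "norm D \<le> L * norm (X ** D)" for D :: "real^'n^'n"
  proof -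
    have "D = matrix_inv X ** (X ** D)" by (simp add: matrix_mul_assoc matrix_inv_mult[OF X])
    then have "norm D \<le> K * (norm (matrix_inv X) * norm (X ** D))"
      using K(2)[of "matrix_inv X" "X ** D"] by simp
    also have "\<dots> \<le> L * norm (X ** D)" by (simp add: L_def distrib_right)
    finally show ?thesis .
  qed
  define C where "C = 2 * L * (K * (norm B + norm (?f X)))"
  have "dist (?f Y) (?f X) \<le> C * dist Y X" if Y: "invertible Y" "dist Y X < 1 / (2 * L * K)" for Y
  proof -
    define D where "D = ?f Y - ?f X"
    have "B ** Y = Y ** ?f Y" "B ** X = X ** ?f X" using similarity_eq_iff X Y(1) by blast+
    then have YD: "Y ** D = B ** (Y - X) - (Y - X) ** ?f X"
      by (simp add: D_def matrix_mult_diff_left matrix_mult_diff_right)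
    have "norm (Y ** D) \<le> norm (B ** (Y - X)) + norm ((Y - X) ** ?f X)"
      unfolding YD by (rule norm_triangle_ineq4)
    also have "\<dots> \<le> K * (norm B * norm (Y - X)) + K * (norm (Y - X) * norm (?f X))"
      by (intro add_mono K)
    finally have upper: "norm (Y ** D) \<le> K * (norm B + norm (?f X)) * norm (Y - X)"
      by (simp add: algebra_simps)
    have "X ** D = Y ** D - (Y - X) ** D" by (simp add: matrix_mult_diff_left)
    then have "norm (X ** D) \<le> norm (Y ** D) + norm ((Y - X) ** D)"
      by (metis norm_triangle_ineq4)
    also have "\<dots> \<le> norm (Y ** D) + K * (norm (Y - X) * norm D)" using K(2) by simp
    finally have "L * norm (X ** D) \<le> L * norm (Y ** D) + (L * K * norm (Y - X)) * norm D"
      using L mult_left_mono[of "norm (X ** D)" _ L] by (fastforce simp: algebra_simps)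
    moreover have "L * K * norm (Y - X) \<le> 1 / 2"
      using Y(2) L K(1) by (simp add: dist_norm field_simps)
    then have "(L * K * norm (Y - X)) * norm D \<le> 1 / 2 * norm D" by (rule mult_right_mono) simp
    ultimately have "norm D \<le> 2 * (L * norm (Y ** D))" using below[of D] by simp
    also have "\<dots> \<le> 2 * (L * (K * (norm B + norm (?f X)) * norm (Y - X)))"
      using upper L by (intro mult_left_mono) auto
    finally show ?thesis by (simp add: D_def C_def dist_norm algebra_simps)
  qed
  moreover have "0 < 1 / (2 * L * K)" using L K(1) by simp
  ultimately show "\<exists>C. \<exists>e>0. \<forall>Y\<in>{X. invertible X}. dist Y X < e \<longrightarrow> dist (?f Y) (?f X) \<le> C * dist Y X"
    by blast
qed

text \<open>
  If \<open>Z ** X\<close> is orthogonal to \<open>Z\<close> then \<open>Z = 0\<close>: near the identity, multiplication by \<open>X\<close> moves no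
  element of a subspace into its orthogonal complement.
\<close>

lemma slice_transversal:
  fixes X Z :: "real^'n^'n"
  assumes K: "\<And>(A::real^'n^'n) (B::real^'n^'n). norm (A ** B) \<le> K * (norm A * norm B)"
    and X: "K * norm (X - mat 1) \<le> 1 / 2"
  shows "(norm Z)\<^sup>2 \<le> 2 * (Z \<bullet> (Z ** X))"
proof -
  have "Z ** X = Z + Z ** (X - mat 1)" by (simp add: matrix_mult_diff_right)
  then have "Z \<bullet> (Z ** X) = (norm Z)\<^sup>2 + Z \<bullet> (Z ** (X - mat 1))"
    by (simp add: inner_add_right dot_square_norm)
  moreover have "\<bar>Z \<bullet> (Z ** (X - mat 1))\<bar> \<le> (norm Z)\<^sup>2 / 2"
  proof -
    have "\<bar>Z \<bullet> (Z ** (X - mat 1))\<bar> \<le> norm Z * norm (Z ** (X - mat 1))" by (rule Cauchy_Schwarz_ineq2)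
    also have "\<dots> \<le> norm Z * (K * (norm Z * norm (X - mat 1)))" by (intro mult_left_mono K) auto
    also have "\<dots> = (norm Z)\<^sup>2 * (K * norm (X - mat 1))" by (simp add: power2_eq_square)
    also have "\<dots> \<le> (norm Z)\<^sup>2 * (1 / 2)" using X by (intro mult_left_mono) auto
    finally show ?thesis by simp
  qed
  ultimately show ?thesis by linarith
qed

text \<open>
  By transversality the subspace \<open>S ** X\<close> meets the orthogonal complement of \<open>S\<close> only in \<open>0\<close>; their
  dimensions add up to that of the whole space, so the identity decomposes along them.
\<close>

lemma move_into_slice:
  fixes X :: "real^'n^'n"
  assumes K: "\<And>(A::real^'n^'n) (B::real^'n^'n). norm (A ** B) \<le> K * (norm A * norm B)"
    and X: "K * norm (X - mat 1) \<le> 1 / 2"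
    and S: "subspace S" "mat 1 \<in> S"
  shows "\<exists>Z\<in>S. (\<forall>W\<in>S. orthogonal W (Z ** X - mat 1)) \<and> norm (Z - mat 1) \<le> 2 * norm (X - mat 1)"
proof -
  define C where "C = {Y::real^'n^'n. \<forall>W\<in>S. orthogonal W Y}"
  define T where "T = (\<lambda>Z. Z ** X) ` S"
  have lin: "linear (\<lambda>Z::real^'n^'n. Z ** X)"
    by (rule bounded_linear.linear[OF bounded_bilinear.bounded_linear_left[OF bounded_bilinear_matrix_mult]])
  have zero: "Z = 0" if "Z \<in> S" "Z ** X \<in> C" for Z
    using slice_transversal[OF K X, of Z] that by (auto simp: C_def orthogonal_def)
  have C: "subspace C" unfolding C_def
    by (auto simp: subspace_def orthogonal_def inner_add_right)
  have TC: "T \<inter> C = {0}"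
    using zero subspace_0[OF C] subspace_0[OF S(1)] by (force simp: T_def)
  have dimT: "dim T = dim S"
    unfolding T_def
  proof (rule dim_image_eq[OF lin])
    show "inj_on (\<lambda>Z. Z ** X) (span S)"
    proof (rule inj_onI)
      fix Y Z assume "Y \<in> span S" "Z \<in> span S" "Y ** X = Z ** X"
      then have "Y - Z \<in> S" "(Y - Z) ** X = 0"
        using S(1) by (simp_all add: span_eq_iff[THEN iffD2] subspace_diff matrix_mult_diff_left)
      then show "Y = Z" using zero[of "Y - Z"] subspace_0[OF C] by simp
    qed
  qed
  have T: "subspace T" unfolding T_def by (rule linear_subspace_image[OF lin S(1)])
  have dimC: "dim C + dim S = DIM(real^'n^'n)"
    using dim_subspace_orthogonal_to_vectors[OF S(1) subspace_UNIV] by (simp add: C_def dim_UNIV)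
  have "dim {x + y |x y. x \<in> T \<and> y \<in> C} = DIM(real^'n^'n)"
  proof -
    have "dim (T \<inter> C) = 0" unfolding TC by (simp only: dim_singleton if_True simp_thms)
    then show ?thesis using dim_sums_Int[OF T C] dimT dimC by linarith
  qed
  then have full: "span {x + y |x y. x \<in> T \<and> y \<in> C} = UNIV" using dim_eq_full by blast
  have "mat 1 \<in> {x + y |x y. x \<in> T \<and> y \<in> C}"
    using full span_eq_iff[THEN iffD2, OF subspace_sums[OF T C]] by simp
  then obtain Z Y where Z: "Z \<in> S" "Y \<in> C" "mat 1 = Z ** X + Y" by (auto simp: T_def)
  have orth: "orthogonal W (Z ** X - mat 1)" if "W \<in> S" for W
    using Z(2) that by (simp add: Z(3) C_def orthogonal_def)
  have "norm (Z - mat 1) \<le> 2 * norm (X - mat 1)"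
  proof -
    define D where "D = Z - mat 1"
    have "D \<in> S" unfolding D_def using S Z(1) by (simp add: subspace_diff)
    then have "D \<bullet> (Z ** X - mat 1) = 0" using orth by (simp add: orthogonal_def)
    moreover have "D ** X = (Z ** X - mat 1) - (X - mat 1)" by (simp add: D_def matrix_mult_diff_left)
    ultimately have "D \<bullet> (D ** X) = - (D \<bullet> (X - mat 1))" by (simp add: inner_diff_right)
    also have "\<dots> \<le> norm D * norm (X - mat 1)" using Cauchy_Schwarz_ineq2[of D "X - mat 1"] by linarith
    finally have "norm D * norm D \<le> norm D * (2 * norm (X - mat 1))"
      using slice_transversal[OF K X, of D] by (simp add: power2_eq_square)
    then show ?thesis unfolding D_def[symmetric] by (cases "D = 0") simp_all
  qed
  then show ?thesis using Z(1) orth by blast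
qed

text \<open>
  The orbit is the union of countably many images of the slice: every invertible \<open>X\<close> is close to some
  \<open>P\<close> of a countable set, and after multiplication by an element of the centralizer, which does not
  change the conjugate of \<open>B\<close>, the matrix \<open>X P\<^sup>-\<^sup>1\<close> lies in the slice. The slice itself is
  parametrized by a proper subspace of \<open>'b\<close>, which is a null set.
\<close>

lemma lipschitz_image_of_orbit_negligible:
  fixes B :: "real^'n^'n" and F :: "real^'n^'n \<Rightarrow> 'b::euclidean_space"
  assumes dim: "DIM(real^'n^'n) < DIM('b) + dim (centralizer B)"
    and F: "pointwise_lipschitz_on (orbit B) F"
  shows "negligible (F ` orbit B)"
proof -
  obtain K where K: "1 \<le> K" "\<And>(A::real^'n^'n) (B::real^'n^'n). norm (A ** B) \<le> K * (norm A * norm B)"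
    "\<And>(A::real^'n^'n) x. norm (A *v x) \<le> K * (norm A * norm x)"
    using matrix_mult_norm_bound by blast
  let ?f = "\<lambda>X::real^'n^'n. matrix_inv X ** B ** X"
  define C where "C = {Y::real^'n^'n. \<forall>W\<in>centralizer B. orthogonal W Y}"
  have C: "subspace C" unfolding C_def
    by (auto simp: subspace_def orthogonal_def inner_add_right)
  have "dim C + dim (centralizer B) = DIM(real^'n^'n)"
    using dim_subspace_orthogonal_to_vectors[OF subspace_centralizer subspace_UNIV, of B]
    by (simp only: C_def dim_UNIV UNIV_I simp_thms subset_UNIV)
  then have dimC: "dim C < DIM('b)" using dim by linarith
  then obtain V :: "'b set" where V: "subspace V" "dim V = dim C"
    using choose_subspace_of_subspace[of "dim C" "UNIV :: 'b set"] by (metis dim_UNIV less_imp_le)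
  obtain h :: "'b \<Rightarrow> real^'n^'n" where h: "linear h" "h ` V = C"
    using isometries_subspaces[OF V(1) C V(2)] by metis
  define \<delta> where "\<delta> = 1 / (4 * K)"
  have \<delta>: "0 < \<delta>" using K(1) by (simp add: \<delta>_def)
  define N where "N P = {X. norm (X ** matrix_inv P - mat 1) < \<delta>}" for P :: "real^'n^'n"
  have openN: "open (N P)" for P
  proof -
    have "continuous_on UNIV (\<lambda>X::real^'n^'n. norm (X ** matrix_inv P - mat 1))"
      by (intro continuous_intros linear_continuous_on bounded_bilinear.bounded_linear_left[OF bounded_bilinear_matrix_mult])
    then show ?thesis unfolding N_def by (intro open_Collect_less continuous_on_const)
  qed
  obtain \<F> where \<F>: "\<F> \<subseteq> N ` {P. invertible P}" "countable \<F>" "\<Union>\<F> = \<Union>(N ` {P. invertible P})"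
    using Lindelof[of "N ` {P. invertible P}"] openN by blast
  then obtain Q where Q: "countable Q" "Q \<subseteq> {P. invertible P}" "\<F> = N ` Q"
    by (metis countable_subset_image)
  define A where "A P = {v \<in> V. invertible (mat 1 + h v)}" for P :: "real^'n^'n"
  define g where "g P v = ?f ((mat 1 + h v) ** P)" for P v
  have "orbit B \<subseteq> (\<Union>P\<in>Q. g P ` A P)"
  proof
    fix Y assume "Y \<in> orbit B"
    then obtain X where X: "invertible X" "Y = ?f X" by (auto simp: orbit_def)
    then have "X \<in> N X" using \<delta> by (simp add: N_def matrix_inv_mult)
    then have "X \<in> \<Union>\<F>" using X(1) \<F>(3) by blast
    then obtain P where P: "P \<in> Q" "X \<in> N P" using Q(3) by blast
    have invP: "invertible P" using P(1) Q(2) by blast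
    define W where "W = X ** matrix_inv P"
    have WP: "W ** P = X"
      using matrix_inv_mult[OF invP] by (simp add: W_def flip: matrix_mul_assoc)
    have W: "K * norm (W - mat 1) < 1 / 4" using P(2) K(1) by (simp add: N_def W_def \<delta>_def field_simps)
    obtain Z where Z: "Z \<in> centralizer B" "\<forall>U\<in>centralizer B. orthogonal U (Z ** W - mat 1)"
      "norm (Z - mat 1) \<le> 2 * norm (W - mat 1)"
      using move_into_slice[OF K(2) _ subspace_centralizer mat_1_in_centralizer, of W B] W by force
    have "K * norm (Z - mat 1) \<le> K * (2 * norm (W - mat 1))" using Z(3) K(1) by (intro mult_left_mono) auto
    then have invZ: "invertible Z" using W by (intro invertible_near_mat_1[OF K(3)]) auto
    have invW: "invertible W" using W by (intro invertible_near_mat_1[OF K(3)]) auto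
    have "Z ** W - mat 1 \<in> h ` V" unfolding h(2) C_def using Z(2) by simp
    then obtain v where v: "v \<in> V" "Z ** W - mat 1 = h v" by blast
    then have ZW: "mat 1 + h v = Z ** W" by (simp add: algebra_simps)
    then have "v \<in> A P" using v(1) invertible_mult[OF invZ invW] by (simp add: A_def)
    moreover have "g P v = Y"
      unfolding g_def ZW X(2)
      using similarity_centralizer_mult[OF X(1) invZ Z(1)] WP by (metis matrix_mul_assoc)
    ultimately show "Y \<in> (\<Union>P\<in>Q. g P ` A P)" using P(1) by blast
  qed
  then have "F ` orbit B \<subseteq> (\<Union>P\<in>Q. (\<lambda>v. F (g P v)) ` A P)" by blast
  moreover have "negligible (\<Union>P\<in>Q. (\<lambda>v. F (g P v)) ` A P)"
  proof (rule negligible_countable_Union)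
    show "countable ((\<lambda>P. (\<lambda>v. F (g P v)) ` A P) ` Q)" using Q(1) by simp
    fix S assume "S \<in> (\<lambda>P. (\<lambda>v. F (g P v)) ` A P) ` Q"
    then obtain P where P: "P \<in> Q" "S = (\<lambda>v. F (g P v)) ` A P" by blast
    have inv: "invertible ((mat 1 + h v) ** P)" if "v \<in> A P" for v
      using that P(1) Q(2) by (intro invertible_mult) (auto simp: A_def)
    have affine: "pointwise_lipschitz_on (A P) (\<lambda>v. (mat 1 + h v) ** P)"
    proof -
      have "bounded_linear (\<lambda>v. h v ** P)"
        using h(1) by (intro bounded_linear_compose[OF bounded_bilinear.bounded_linear_left[OF bounded_bilinear_matrix_mult]])
          (simp add: linear_conv_bounded_linear)
      then have "pointwise_lipschitz_on (A P) (\<lambda>v. mat 1 ** P + h v ** P)"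
        by (intro pointwise_lipschitz_on_add pointwise_lipschitz_on_const pointwise_lipschitz_on_bounded_linear)
      then show ?thesis by (simp only: matrix_mult_add_left)
    qed
    have "pointwise_lipschitz_on (A P) (g P)"
      unfolding g_def
      by (rule pointwise_lipschitz_on_compose[OF affine pointwise_lipschitz_on_similarity])
        (use inv in blast)
    then have "pointwise_lipschitz_on (A P) (\<lambda>v. F (g P v))"
      by (rule pointwise_lipschitz_on_compose[OF _ F]) (use inv in \<open>auto simp: g_def orbit_def\<close>)
    moreover have "negligible (A P)"
    proof (rule negligible_subset)
      show "negligible V" using V(2) dimC by (intro negligible_lowdim) simp
      show "A P \<subseteq> V" by (auto simp: A_def)
    qed
    ultimately show "negligible S" unfolding P(2) by (intro negligible_pointwise_lipschitz_image) auto
  qed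
  ultimately show ?thesis by (rule negligible_subset[rotated])
qed

text \<open>
  If two matrices \<open>X\<close>, \<open>Y\<close> of the slice give the same conjugate of \<open>B\<close>, then \<open>Z = Y X\<^sup>-\<^sup>1\<close> lies in the
  centralizer and \<open>(Z - 1) X = Y - X\<close> is orthogonal to the centralizer, whence \<open>Z = 1\<close>. So a small
  ball of the slice embeds into the orbit.
\<close>

lemma orbit_not_covering_dim_le:
  fixes B :: "real^'n^'n"
  assumes dim: "DIM('b::euclidean_space) + dim (centralizer B) = DIM(real^'n^'n)"
    and sub: "orbit B \<subseteq> S"
  shows "\<not> covering_dim_le (top_of_set S) (int DIM('b) - 1)"
proof -
  obtain K where K: "1 \<le> K" "\<And>(A::real^'n^'n) (B::real^'n^'n). norm (A ** B) \<le> K * (norm A * norm B)"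
    "\<And>(A::real^'n^'n) x. norm (A *v x) \<le> K * (norm A * norm x)"
    using matrix_mult_norm_bound by blast
  let ?f = "\<lambda>X::real^'n^'n. matrix_inv X ** B ** X"
  define C where "C = {Y::real^'n^'n. \<forall>W\<in>centralizer B. orthogonal W Y}"
  have C: "subspace C" unfolding C_def
    by (auto simp: subspace_def orthogonal_def inner_add_right)
  have "dim C + dim (centralizer B) = DIM(real^'n^'n)"
    using dim_subspace_orthogonal_to_vectors[OF subspace_centralizer subspace_UNIV, of B]
    by (simp only: C_def dim_UNIV UNIV_I simp_thms subset_UNIV)
  then have "dim (UNIV::'b set) = dim C" using dim unfolding dim_UNIV by linarith
  from isometries_subspaces[OF subspace_UNIV C this] obtain h :: "'b \<Rightarrow> real^'n^'n"
    where h: "linear h" "range h = C" "\<And>x. norm (h x) = norm x"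
    by (metis UNIV_I)
  define r where "r = 1 / (2 * K)"
  have r: "0 < r" using K(1) by (simp add: r_def)
  have small: "K * norm (h v) \<le> 1 / 2" if "v \<in> cball 0 r" for v
    using that K(1) by (simp add: r_def h(3) field_simps)
  have inv: "invertible (mat 1 + h v)" if "v \<in> cball 0 r" for v
    using small[OF that] by (intro invertible_near_mat_1[OF K(3)]) simp
  have lip: "pointwise_lipschitz_on (cball 0 r) (\<lambda>v. ?f (mat 1 + h v))"
  proof (rule pointwise_lipschitz_on_compose[OF _ pointwise_lipschitz_on_similarity])
    show "pointwise_lipschitz_on (cball 0 r) (\<lambda>v. mat 1 + h v)"
      using h(1) by (intro pointwise_lipschitz_on_add pointwise_lipschitz_on_const
          pointwise_lipschitz_on_bounded_linear) (simp add: linear_conv_bounded_linear)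
  qed (use inv in blast)
  have "inj_on (\<lambda>v. ?f (mat 1 + h v)) (cball 0 r)"
  proof (rule inj_onI)
    fix v w assume v: "v \<in> cball 0 r" and w: "w \<in> cball 0 r" and eq: "?f (mat 1 + h v) = ?f (mat 1 + h w)"
    define X where "X = mat 1 + h v"
    define Y where "Y = mat 1 + h w"
    have X: "invertible X" and Y: "invertible Y" using inv v w by (auto simp: X_def Y_def)
    define R where "R = ?f X"
    have "R = ?f Y" unfolding R_def X_def Y_def by (rule eq)
    then have BX: "B ** X = X ** R" and BY: "B ** Y = Y ** R"
      using similarity_eq_iff[OF X, of B R] similarity_eq_iff[OF Y, of B R] by (simp_all add: R_def)
    define Z where "Z = Y ** matrix_inv X"
    have ZX: "Z ** X = Y" using matrix_inv_mult[OF X] by (simp add: Z_def flip: matrix_mul_assoc)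
    have "(Z ** B) ** X = (B ** Z) ** X"
    proof -
      have "(Z ** B) ** X = Z ** (X ** R)" by (simp only: BX flip: matrix_mul_assoc)
      also have "\<dots> = B ** Y" by (simp only: BY ZX matrix_mul_assoc)
      also have "\<dots> = (B ** Z) ** X" by (simp only: ZX flip: matrix_mul_assoc)
      finally show ?thesis .
    qed
    then have "((Z ** B) ** X) ** matrix_inv X = ((B ** Z) ** X) ** matrix_inv X" by simp
    then have "Z ** B = B ** Z" using matrix_inv_mult[OF X] by (simp flip: matrix_mul_assoc)
    then have "Z \<in> centralizer B" by (simp add: centralizer_def)
    then have D: "Z - mat 1 \<in> centralizer B"
      by (rule subspace_diff[OF subspace_centralizer _ mat_1_in_centralizer])
    have "(Z - mat 1) ** X = h w - h v" using ZX by (simp add: matrix_mult_diff_left X_def Y_def)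
    moreover have "h w - h v \<in> C" using h(2) by (intro subspace_diff[OF C]) auto
    ultimately have "(Z - mat 1) \<bullet> ((Z - mat 1) ** X) = 0" using D by (simp add: C_def orthogonal_def)
    moreover have "K * norm (X - mat 1) \<le> 1 / 2" using small[OF v] by (simp add: X_def)
    ultimately have "(norm (Z - mat 1))\<^sup>2 \<le> 0" using slice_transversal[OF K(2), of X "Z - mat 1"] by simp
    then have "Z = mat 1" by simp
    then have "h v = h w" using ZX by (simp add: X_def Y_def)
    then have "norm (v - w) = 0" using h(3)[of "v - w"] by (simp add: linear_diff[OF h(1)])
    then show "v = w" by simp
  qed
  moreover have "(\<lambda>v. ?f (mat 1 + h v)) ` cball 0 r \<subseteq> S"
  proof (rule image_subsetI)
    fix v :: 'b assume "v \<in> cball 0 r"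
    then have "?f (mat 1 + h v) \<in> orbit B" unfolding orbit_def using inv by blast
    then show "?f (mat 1 + h v) \<in> S" using sub by blast
  qed
  ultimately show ?thesis
    using pointwise_lipschitz_on_imp_continuous_on[OF lip]
    by (intro not_covering_dim_le_if_embedded_cball[OF r])
qed

section \<open>Evaluating polynomials at matrices\<close>

text \<open>
  The value of a polynomial at a matrix, by Horner's scheme: this makes \<open>pCons\<close> induction immediate.
\<close>

definition poly_mat :: "real poly \<Rightarrow> real^'n^'n \<Rightarrow> real^'n^'n" where
  "poly_mat p X = fold_coeffs (\<lambda>a M. a *\<^sub>R mat 1 + X ** M) p 0"

lemma poly_mat_0 [simp]: "poly_mat 0 X = 0"
  by (simp add: poly_mat_def)

lemma poly_mat_pCons [simp]: "poly_mat (pCons a p) X = a *\<^sub>R mat 1 + X ** poly_mat p X"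
  by (cases "p = 0 \<and> a = 0") (auto simp: poly_mat_def)

lemma poly_mat_1 [simp]: "poly_mat 1 X = mat 1"
  by (simp add: one_pCons)

lemma poly_mat_add: "poly_mat (p + q) X = poly_mat p X + poly_mat q X"
  by (induction p q rule: poly_induct2) (simp_all add: matrix_add_ldistrib scaleR_add_left)

lemma poly_mat_smult: "poly_mat (smult c p) X = c *\<^sub>R poly_mat p X"
  by (induction p) (simp_all add: matrix_mult_scaleR_right scaleR_add_right)

lemma poly_mat_mult: "poly_mat (p * q) X = poly_mat p X ** poly_mat q X"
  by (induction p)
    (simp_all add: poly_mat_add poly_mat_smult matrix_mult_add_left matrix_mul_assoc matrix_mult_scaleR_left)

lemma poly_mat_sum: "poly_mat (\<Sum>i\<in>I. f i) X = (\<Sum>i\<in>I. poly_mat (f i) X)"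
  by (induction I rule: infinite_finite_induct) (simp_all add: poly_mat_add)

lemma poly_mat_monom: "poly_mat (monom c k) X = c *\<^sub>R matpow X k"
  by (induction k) (simp_all add: monom_0 monom_Suc matrix_mult_scaleR_right)

lemma poly_mat_similar:
  assumes "A ** P = P ** B"
  shows "poly_mat p A ** P = P ** poly_mat p B"
proof (induction p)
  case (pCons c p)
  have "A ** poly_mat p A ** P = A ** P ** poly_mat p B"
    using pCons.IH by (metis matrix_mul_assoc)
  also have "\<dots> = P ** (B ** poly_mat p B)" using assms by (simp add: matrix_mul_assoc)
  finally show ?case
    by (simp add: matrix_mult_add_left matrix_add_ldistrib matrix_mult_scaleR_left matrix_mult_scaleR_right)
qed simp

lemma poly_mat_mult_vec: "poly_mat (p * q) X *v u = poly_mat p X *v (poly_mat q X *v u)"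
  by (simp add: poly_mat_mult matrix_vector_mul_assoc)

lemma poly_mat_linear_vec: "poly_mat [:- c, 1:] X *v u = X *v u - c *\<^sub>R u"
  by (simp add: matrix_vector_mult_add_rdistrib matrix_vector_mult_diff_rdistrib scaleR_matrix_vector_assoc[symmetric])

lemma poly_mat_eigenvector:
  assumes "X *v u = c *\<^sub>R u"
  shows "poly_mat p X *v u = poly p c *\<^sub>R u"
  using assms by (induction p)
    (simp_all add: matrix_vector_mult_add_rdistrib scaleR_matrix_vector_assoc[symmetric]
      matrix_vector_mul_assoc[symmetric] matrix_vector_mult_scaleR scaleR_add_left mult.commute)

lemma poly_mat_orbit_eq_0:
  assumes "A \<in> orbit B" "poly_mat p B = 0"
  shows "poly_mat p A = 0"
proof -
  obtain X where X: "invertible X" "A = matrix_inv X ** B ** X" using assms(1) by (auto simp: orbit_def)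
  then have "B ** X = X ** A" using similarity_eq_iff by blast
  then have "X ** poly_mat p A = 0" using poly_mat_similar[of B X A p] assms(2) by simp
  then have "(matrix_inv X ** X) ** poly_mat p A = 0" by (simp flip: matrix_mul_assoc)
  then show ?thesis using matrix_inv_mult[OF X(1)] by simp
qed

lemma solution_set_eq: "solution_set n a = {X. poly_mat (scalar_poly n a) X = 0}"
  by (simp add: solution_set_def scalar_poly_def poly_mat_add poly_mat_sum poly_mat_monom)

lemma cayley_hamilton_3:
  fixes A :: "real^3^3"
  defines "t \<equiv> A$1$1 + A$2$2 + A$3$3"
    and "c \<equiv> A$1$1 * A$2$2 - A$1$2 * A$2$1 + A$1$1 * A$3$3 - A$1$3 * A$3$1 + A$2$2 * A$3$3 - A$2$3 * A$3$2"
  defines "\<psi> \<equiv> [:- det A, c, - t, 1:]"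
  shows "poly_mat \<psi> A = 0" "det (A - x *\<^sub>R mat 1) = - poly \<psi> x"
  unfolding \<psi>_def t_def c_def
  by (simp_all add: vec_eq_iff forall_3 matrix_matrix_mult_def sum_3 det_3 mat_def algebra_simps)

lemma real_cubic_has_root: "\<exists>x. poly [:d, c, t, 1:] x = (0::real)"
proof -
  define M where "M = 1 + \<bar>d\<bar> + \<bar>c\<bar> + \<bar>t\<bar>"
  have M: "1 \<le> M" by (simp add: M_def)
  have MM: "M \<le> M\<^sup>2" "1 \<le> M\<^sup>2" using M by (simp_all add: power2_eq_square mult_le_cancel_left1 one_le_power[of M 2, unfolded power2_eq_square])
  have bound: "\<bar>d + c * x + t * x\<^sup>2\<bar> < M ^ 3" if "\<bar>x\<bar> = M" for x
  proof -
    have xx: "x\<^sup>2 = M\<^sup>2" unfolding that[symmetric] by simp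
    have "\<bar>d + c * x + t * x\<^sup>2\<bar> \<le> \<bar>d\<bar> + \<bar>c * x\<bar> + \<bar>t * x\<^sup>2\<bar>" by linarith
    also have "\<dots> = \<bar>d\<bar> * 1 + \<bar>c\<bar> * M + \<bar>t\<bar> * M\<^sup>2"
      using that xx by (simp add: abs_mult)
    also have "\<dots> \<le> \<bar>d\<bar> * M\<^sup>2 + \<bar>c\<bar> * M\<^sup>2 + \<bar>t\<bar> * M\<^sup>2"
      using M MM by (intro add_mono mult_left_mono) auto
    also have "\<dots> = (M - 1) * M\<^sup>2" by (simp add: M_def algebra_simps)
    also have "\<dots> < M * M\<^sup>2" using M by (intro mult_strict_right_mono) auto
    also have "\<dots> = M ^ 3" by (simp add: power3_eq_cube power2_eq_square)
    finally show ?thesis .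
  qed
  have eval: "poly [:d, c, t, 1:] x = d + c * x + t * x\<^sup>2 + x ^ 3" for x
    by (simp add: algebra_simps power2_eq_square power3_eq_cube)
  have "poly [:d, c, t, 1:] (- M) < 0"
    unfolding eval power_minus_odd[of 3 M, simplified] using bound[of "- M"] M by auto
  moreover have "0 < poly [:d, c, t, 1:] M"
    unfolding eval using bound[of M] M by auto
  ultimately show ?thesis using poly_IVT_pos[of "- M" M] M by fastforce
qed

text \<open>
  The characteristic polynomial has odd degree.
\<close>

lemma ex_real_eigenvector_3:
  fixes A :: "real^3^3"
  shows "\<exists>c u. u \<noteq> 0 \<and> A *v u = c *\<^sub>R u"
proof -
  obtain c where "det (A - c *\<^sub>R mat 1) = 0"
    using real_cubic_has_root cayley_hamilton_3(2)[of A] by (metis neg_equal_0_iff_equal)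
  then have "\<not> invertible (A - c *\<^sub>R mat 1)" by (simp add: invertible_det_nz)
  then obtain u where "u \<noteq> 0" "(A - c *\<^sub>R mat 1) *v u = 0"
    by (auto simp: invertible_left_inverse matrix_left_invertible_ker)
  then have "A *v u = c *\<^sub>R u"
    by (simp add: matrix_vector_mult_diff_rdistrib scaleR_matrix_vector_assoc[symmetric])
  with \<open>u \<noteq> 0\<close> show ?thesis by blast
qed

lemma poly_mat_eq_0_dvd:
  assumes "m dvd f" "poly_mat m A = 0"
  shows "poly_mat f A = 0"
  using assms by (auto simp: dvd_def poly_mat_mult)

text \<open>
  The remainder of \<open>f\<close> modulo an annihilating polynomial of least degree annihilates as well, so it
  vanishes.
\<close>

lemma ex_minimal_poly:
  assumes "f \<noteq> 0" "poly_mat f A = 0"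
  shows "\<exists>m. lead_coeff m = 1 \<and> poly_mat m A = 0 \<and> m dvd f \<and>
    (\<forall>p. p \<noteq> 0 \<longrightarrow> poly_mat p A = 0 \<longrightarrow> degree m \<le> degree p)"
proof -
  obtain p where p: "p \<noteq> 0" "poly_mat p A = 0"
    and least: "\<And>q. q \<noteq> 0 \<Longrightarrow> poly_mat q A = 0 \<Longrightarrow> degree p \<le> degree q"
    using ex_has_least_nat[of "\<lambda>p. p \<noteq> 0 \<and> poly_mat p A = 0" f degree] assms by blast
  define m where "m = smult (inverse (lead_coeff p)) p"
  have m: "lead_coeff m = 1" "poly_mat m A = 0" "degree m = degree p"
    using p by (simp_all add: m_def poly_mat_smult)
  have "poly_mat f A = poly_mat (f div m) A ** poly_mat m A + poly_mat (f mod m) A"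
    by (metis div_mult_mod_eq poly_mat_add poly_mat_mult)
  then have "poly_mat (f mod m) A = 0" using assms(2) m(2) by simp
  moreover have "m \<noteq> 0" using m(1) by auto
  ultimately have "f mod m = 0"
    using least[of "f mod m"] degree_mod_less[of m f] m(3) by force
  then have "m dvd f" by (simp add: dvd_eq_mod_eq_0)
  then show ?thesis using m least by (intro exI[of _ m]) simp
qed

section \<open>Criteria for similarity to a normal form\<close>

lemma matrix_entries [simp]:
  "J a b c $ 1 $ 1 = a" "J a b c $ 1 $ 2 = 0" "J a b c $ 1 $ 3 = 0"
  "J a b c $ 2 $ 1 = 0" "J a b c $ 2 $ 2 = b" "J a b c $ 2 $ 3 = 0"
  "J a b c $ 3 $ 1 = 0" "J a b c $ 3 $ 2 = 0" "J a b c $ 3 $ 3 = c"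
  "J1 a b c $ 1 $ 1 = a" "J1 a b c $ 1 $ 2 = 1" "J1 a b c $ 1 $ 3 = 0"
  "J1 a b c $ 2 $ 1 = 0" "J1 a b c $ 2 $ 2 = b" "J1 a b c $ 2 $ 3 = 0"
  "J1 a b c $ 3 $ 1 = 0" "J1 a b c $ 3 $ 2 = 0" "J1 a b c $ 3 $ 3 = c"
  "J2 a b c $ 1 $ 1 = a" "J2 a b c $ 1 $ 2 = 1" "J2 a b c $ 1 $ 3 = 0"
  "J2 a b c $ 2 $ 1 = 0" "J2 a b c $ 2 $ 2 = b" "J2 a b c $ 2 $ 3 = 1"
  "J2 a b c $ 3 $ 1 = 0" "J2 a b c $ 3 $ 2 = 0" "J2 a b c $ 3 $ 3 = c"
  "Jc a p q $ 1 $ 1 = a" "Jc a p q $ 1 $ 2 = 0" "Jc a p q $ 1 $ 3 = 0"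
  "Jc a p q $ 2 $ 1 = 0" "Jc a p q $ 2 $ 2 = p" "Jc a p q $ 2 $ 3 = q"
  "Jc a p q $ 3 $ 1 = 0" "Jc a p q $ 3 $ 2 = - q" "Jc a p q $ 3 $ 3 = p"
  by (simp_all add: J_def J1_def J2_def Jc_def)

text \<open>
  The change of basis matrix has the columns \<open>v1\<close>, \<open>v2\<close>, \<open>v3\<close>; the hypotheses say that the columns of
  \<open>B\<close> are the coordinates of their images under \<open>A\<close>.
\<close>

lemma in_orbit_if_basis:
  fixes A B :: "real^3^3"
  assumes indep: "\<And>x y z. x *\<^sub>R v1 + y *\<^sub>R v2 + z *\<^sub>R v3 = 0 \<Longrightarrow> x = 0 \<and> y = 0 \<and> z = 0"
    and "A *v v1 = B$1$1 *\<^sub>R v1 + B$2$1 *\<^sub>R v2 + B$3$1 *\<^sub>R v3"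
    and "A *v v2 = B$1$2 *\<^sub>R v1 + B$2$2 *\<^sub>R v2 + B$3$2 *\<^sub>R v3"
    and "A *v v3 = B$1$3 *\<^sub>R v1 + B$2$3 *\<^sub>R v2 + B$3$3 *\<^sub>R v3"
  shows "A \<in> orbit B"
proof -
  define P :: "real^3^3" where "P = (\<chi> i. vector [v1 $ i, v2 $ i, v3 $ i])"
  have P_vec: "P *v x = x$1 *\<^sub>R v1 + x$2 *\<^sub>R v2 + x$3 *\<^sub>R v3" for x
    by (simp add: P_def vec_eq_iff matrix_vector_mult_def sum_3)
  have "x = 0" if "P *v x = 0" for x
    using indep[of "x$1" "x$2" "x$3"] that unfolding P_vec by (simp add: vec_eq_iff forall_3)
  then have inv: "invertible P" by (simp add: invertible_left_inverse matrix_left_invertible_ker)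
  have "A *v (P *v x) = P *v (B *v x)" for x
    unfolding P_vec matrix_vector_right_distrib matrix_vector_mult_scaleR assms(2-4)
    by (simp add: vec_eq_iff matrix_vector_mult_def sum_3 algebra_simps)
  then have AP: "A ** P = P ** B" by (simp add: matrix_eq matrix_vector_mul_assoc)
  have "B ** matrix_inv P = (matrix_inv P ** P) ** (B ** matrix_inv P)"
    using matrix_inv_mult[OF inv] by simp
  also have "\<dots> = matrix_inv P ** (P ** B) ** matrix_inv P" by (simp add: matrix_mul_assoc)
  also have "\<dots> = matrix_inv P ** A ** (P ** matrix_inv P)" unfolding AP[symmetric] by (simp add: matrix_mul_assoc)
  also have "\<dots> = matrix_inv P ** A" using matrix_inv_mult[OF inv] by simp
  finally have "B ** matrix_inv P = matrix_inv P ** A" .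
  moreover have inv': "invertible (matrix_inv P)"
    using matrix_inv_mult[OF inv] unfolding invertible_def by blast
  ultimately have "A = matrix_inv (matrix_inv P) ** B ** matrix_inv P"
    using similarity_eq_iff[OF inv'] by metis
  then show ?thesis unfolding orbit_def using inv' by blast
qed

lemma indep_pair:
  fixes v w :: "'a::real_vector"
  assumes "v \<noteq> 0" "w \<notin> span {v}" "x *\<^sub>R v + y *\<^sub>R w = 0"
  shows "x = 0 \<and> y = 0"
proof -
  have "y = 0"
  proof (rule ccontr)
    assume "y \<noteq> 0"
    then have "w = inverse y *\<^sub>R (y *\<^sub>R w)" by simp
    also have "y *\<^sub>R w = - (x *\<^sub>R v)" using assms(3) by (simp add: eq_neg_iff_add_eq_0 add.commute)
    finally have "w \<in> span {v}" by (metis span_neg span_scale span_base singletonI)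
    then show False using assms(2) by blast
  qed
  then show ?thesis using assms by simp
qed

lemma orbit_J_distinct:
  fixes A :: "real^3^3"
  assumes neq: "a \<noteq> b" "a \<noteq> c" "b \<noteq> c" and nz: "v1 \<noteq> 0" "v2 \<noteq> 0" "v3 \<noteq> 0"
    and A: "A *v v1 = a *\<^sub>R v1" "A *v v2 = b *\<^sub>R v2" "A *v v3 = c *\<^sub>R v3"
  shows "A \<in> orbit (J a b c)"
proof (rule in_orbit_if_basis[of v1 v2 v3])
  fix x y z assume R: "x *\<^sub>R v1 + y *\<^sub>R v2 + z *\<^sub>R v3 = 0"
  have E: "poly_mat p A *v (x *\<^sub>R v1 + y *\<^sub>R v2 + z *\<^sub>R v3) =
      (x * poly p a) *\<^sub>R v1 + (y * poly p b) *\<^sub>R v2 + (z * poly p c) *\<^sub>R v3" for p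
    by (simp add: matrix_vector_right_distrib matrix_vector_mult_scaleR
        poly_mat_eigenvector[OF A(1)] poly_mat_eigenvector[OF A(2)] poly_mat_eigenvector[OF A(3)])
  show "x = 0 \<and> y = 0 \<and> z = 0"
    using E[of "[:-b, 1:] * [:-c, 1:]"] E[of "[:-a, 1:] * [:-c, 1:]"] E[of "[:-a, 1:] * [:-b, 1:]"] neq nz
    unfolding R by (simp del: mult_pCons_left mult_pCons_right)
qed (use A in simp_all)

lemma orbit_J_double:
  fixes A :: "real^3^3"
  assumes "a \<noteq> b" "v1 \<noteq> 0" "v2 \<notin> span {v1}" "v3 \<noteq> 0"
    and A: "A *v v1 = a *\<^sub>R v1" "A *v v2 = a *\<^sub>R v2" "A *v v3 = b *\<^sub>R v3"
  shows "A \<in> orbit (J a a b)"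
proof (rule in_orbit_if_basis[of v1 v2 v3])
  fix x y z assume R: "x *\<^sub>R v1 + y *\<^sub>R v2 + z *\<^sub>R v3 = 0"
  have E: "poly_mat p A *v (x *\<^sub>R v1 + y *\<^sub>R v2 + z *\<^sub>R v3) =
      (x * poly p a) *\<^sub>R v1 + (y * poly p a) *\<^sub>R v2 + (z * poly p b) *\<^sub>R v3" for p
    by (simp add: matrix_vector_right_distrib matrix_vector_mult_scaleR
        poly_mat_eigenvector[OF A(1)] poly_mat_eigenvector[OF A(2)] poly_mat_eigenvector[OF A(3)])
  have z: "z = 0" using E[of "[:-a, 1:]"] assms(1,4) unfolding R by simp
  then have "x *\<^sub>R v1 + y *\<^sub>R v2 = 0" using R by simp
  then show "x = 0 \<and> y = 0 \<and> z = 0" using z indep_pair[OF assms(2,3)] by blast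
qed (use A in simp_all)

lemma orbit_J1_double:
  fixes A :: "real^3^3"
  assumes "a \<noteq> b" "v1 \<noteq> 0" "v3 \<noteq> 0"
    and A: "A *v v1 = a *\<^sub>R v1" "A *v v2 = v1 + a *\<^sub>R v2" "A *v v3 = b *\<^sub>R v3"
  shows "A \<in> orbit (J1 a a b)"
proof (rule in_orbit_if_basis[of v1 v2 v3])
  fix x y z assume R: "x *\<^sub>R v1 + y *\<^sub>R v2 + z *\<^sub>R v3 = 0"
  define E where "E u = A *v u - a *\<^sub>R u" for u
  have E: "E (s + t) = E s + E t" "E (k *\<^sub>R s) = k *\<^sub>R E s" for s t k
    by (simp_all add: E_def matrix_vector_right_distrib matrix_vector_mult_scaleR algebra_simps)
  have Ev: "E v1 = 0" "E v2 = v1" "E v3 = (b - a) *\<^sub>R v3" "E 0 = 0"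
    by (simp_all add: E_def A algebra_simps)
  have R1: "y *\<^sub>R v1 + (z * (b - a)) *\<^sub>R v3 = 0" using arg_cong[OF R, of E] by (simp add: E Ev)
  have "(z * (b - a) * (b - a)) *\<^sub>R v3 = 0" using arg_cong[OF R1, of E] by (simp add: E Ev)
  then have z: "z = 0" using assms by simp
  then have "y = 0" using R1 assms by simp
  then show "x = 0 \<and> y = 0 \<and> z = 0" using z R assms by simp
qed (use A in simp_all)

lemma orbit_J1_triple:
  fixes A :: "real^3^3"
  assumes "v1 \<noteq> 0" "v3 \<notin> span {v1}"
    and A: "A *v v1 = a *\<^sub>R v1" "A *v v2 = v1 + a *\<^sub>R v2" "A *v v3 = a *\<^sub>R v3"
  shows "A \<in> orbit (J1 a a a)"
proof (rule in_orbit_if_basis[of v1 v2 v3])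
  fix x y z assume R: "x *\<^sub>R v1 + y *\<^sub>R v2 + z *\<^sub>R v3 = 0"
  define E where "E u = A *v u - a *\<^sub>R u" for u
  have E: "E (s + t) = E s + E t" "E (k *\<^sub>R s) = k *\<^sub>R E s" for s t k
    by (simp_all add: E_def matrix_vector_right_distrib matrix_vector_mult_scaleR algebra_simps)
  have Ev: "E v1 = 0" "E v2 = v1" "E v3 = 0" "E 0 = 0"
    by (simp_all add: E_def A algebra_simps)
  have y: "y = 0" using arg_cong[OF R, of E] assms(1) by (simp add: E Ev)
  then have "x *\<^sub>R v1 + z *\<^sub>R v3 = 0" using R by simp
  then show "x = 0 \<and> y = 0 \<and> z = 0" using y indep_pair[OF assms(1,2)] by blast
qed (use A in simp_all)

lemma orbit_J2_triple:
  fixes A :: "real^3^3"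
  assumes "v1 \<noteq> 0"
    and A: "A *v v1 = a *\<^sub>R v1" "A *v v2 = v1 + a *\<^sub>R v2" "A *v v3 = v2 + a *\<^sub>R v3"
  shows "A \<in> orbit (J2 a a a)"
proof (rule in_orbit_if_basis[of v1 v2 v3])
  fix x y z assume R: "x *\<^sub>R v1 + y *\<^sub>R v2 + z *\<^sub>R v3 = 0"
  define E where "E u = A *v u - a *\<^sub>R u" for u
  have E: "E (s + t) = E s + E t" "E (k *\<^sub>R s) = k *\<^sub>R E s" for s t k
    by (simp_all add: E_def matrix_vector_right_distrib matrix_vector_mult_scaleR algebra_simps)
  have Ev: "E v1 = 0" "E v2 = v1" "E v3 = v2" "E 0 = 0"
    by (simp_all add: E_def A algebra_simps)
  have R1: "y *\<^sub>R v1 + z *\<^sub>R v2 = 0" using arg_cong[OF R, of E] by (simp add: E Ev)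
  have "z *\<^sub>R v1 = 0" using arg_cong[OF R1, of E] by (simp add: E Ev)
  then have z: "z = 0" using assms by simp
  then have "y = 0" using R1 assms by simp
  then show "x = 0 \<and> y = 0 \<and> z = 0" using z R assms by simp
qed (use A in simp_all)

text \<open>
  On the plane of \<open>v2\<close> and \<open>v3\<close> the matrix acts as multiplication by a non-real number, which has no
  real eigenvector; this gives the independence of \<open>v2\<close> and \<open>v3\<close> first and of all three vectors then.
\<close>

lemma orbit_Jc:
  fixes A :: "real^3^3"
  assumes "q \<noteq> 0" "v1 \<noteq> 0" "v2 \<noteq> 0"
    and A: "A *v v1 = a *\<^sub>R v1" "A *v v2 = p *\<^sub>R v2 - q *\<^sub>R v3" "A *v v3 = q *\<^sub>R v2 + p *\<^sub>R v3"
  shows "A \<in> orbit (Jc a p q)"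
proof (rule in_orbit_if_basis[of v1 v2 v3])
  have indep: "y = 0 \<and> z = 0" if R: "y *\<^sub>R v2 + z *\<^sub>R v3 = 0" for y z
  proof -
    have "p *\<^sub>R (y *\<^sub>R v2 + z *\<^sub>R v3) + q *\<^sub>R (z *\<^sub>R v2 - y *\<^sub>R v3) = A *v (y *\<^sub>R v2 + z *\<^sub>R v3)"
      by (simp add: matrix_vector_right_distrib matrix_vector_mult_scaleR A algebra_simps)
    then have R': "z *\<^sub>R v2 - y *\<^sub>R v3 = 0" using \<open>q \<noteq> 0\<close> unfolding R by simp
    have "(y * y + z * z) *\<^sub>R v2 = y *\<^sub>R (y *\<^sub>R v2 + z *\<^sub>R v3) + z *\<^sub>R (z *\<^sub>R v2 - y *\<^sub>R v3)"
      by (simp add: algebra_simps)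
    then show ?thesis using \<open>v2 \<noteq> 0\<close> unfolding R R' by (simp add: sum_squares_eq_zero_iff)
  qed
  fix x y z assume R: "x *\<^sub>R v1 + y *\<^sub>R v2 + z *\<^sub>R v3 = 0"
  have "(y * (p - a) + z * q) *\<^sub>R v2 + (z * (p - a) - y * q) *\<^sub>R v3
      = A *v (x *\<^sub>R v1 + y *\<^sub>R v2 + z *\<^sub>R v3) - a *\<^sub>R (x *\<^sub>R v1 + y *\<^sub>R v2 + z *\<^sub>R v3)"
    by (simp add: matrix_vector_right_distrib matrix_vector_mult_scaleR A algebra_simps)
  then have "y * (p - a) + z * q = 0 \<and> z * (p - a) - y * q = 0"
    unfolding R by (intro indep) simp
  then have "((p - a)\<^sup>2 + q\<^sup>2) * y = 0" "((p - a)\<^sup>2 + q\<^sup>2) * z = 0" by algebra+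
  moreover have "0 < (p - a)\<^sup>2 + q\<^sup>2" using \<open>q \<noteq> 0\<close> by (simp add: add_nonneg_pos)
  ultimately have "y = 0" "z = 0" by auto
  then show "x = 0 \<and> y = 0 \<and> z = 0" using R \<open>v1 \<noteq> 0\<close> by simp
qed (use A in simp_all)
lemma ex_outside_span:
  fixes S :: "(real^3) set"
  assumes "finite S" "card S \<le> 2"
  shows "\<exists>x. x \<notin> span S"
proof (rule ccontr)
  assume "\<not> (\<exists>x. x \<notin> span S)"
  then have "(UNIV :: (real^3) set) \<subseteq> span S" by blast
  then have "dim (UNIV :: (real^3) set) \<le> card S" using assms(1) by (rule dim_le_card)
  then show False using assms(2) by (simp add: dim_UNIV)
qed

lemma ex_vec_poly_mat_nonzero: "poly_mat p A \<noteq> 0 \<Longrightarrow> \<exists>u. poly_mat p A *v u \<noteq> 0"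
  by (auto simp: matrix_eq)

text \<open>
  The range of \<open>A - b\<close> consists of eigenvectors for \<open>a\<close>, and vice versa. Take one nonzero vector from
  each range. A vector \<open>x\<close> outside their span satisfies \<open>(a - b) x = (A - b) x - (A - a) x\<close>, so one of
  the two eigenspaces contains a second independent vector. Which one decides between the two normal
  forms.
\<close>

lemma orbit_if_annihilated_by_two_roots:
  fixes A :: "real^3^3"
  assumes "a \<noteq> b" and A: "poly_mat ([:- a, 1:] * [:- b, 1:]) A = 0"
    and "poly_mat [:- a, 1:] A \<noteq> 0" "poly_mat [:- b, 1:] A \<noteq> 0"
  shows "A \<in> orbit (J a a b) \<or> A \<in> orbit (J b b a)"
proof -
  define E where "E c u = A *v u - c *\<^sub>R u" for c u
  have ab: "E a (E b u) = 0" for u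
    using A poly_mat_mult_vec[of "[:- a, 1:]" "[:- b, 1:]" A u] unfolding poly_mat_linear_vec E_def by simp
  have ba: "E b (E a u) = 0" for u
    using A poly_mat_mult_vec[of "[:- b, 1:]" "[:- a, 1:]" A u]
    unfolding poly_mat_linear_vec E_def mult.commute[of "[:- b, 1:]"] by simp
  obtain u where u: "E a u \<noteq> 0"
    using ex_vec_poly_mat_nonzero[OF assms(3)] unfolding poly_mat_linear_vec E_def by blast
  obtain w where w: "E b w \<noteq> 0"
    using ex_vec_poly_mat_nonzero[OF assms(4)] unfolding poly_mat_linear_vec E_def by blast
  have eig: "A *v x = c *\<^sub>R x" if "E c x = 0" for c x using that by (simp add: E_def)
  have "card {E b w, E a u} \<le> 2" by (simp add: card_insert_if)
  then obtain x where x: "x \<notin> span {E b w, E a u}" using ex_outside_span[of "{E b w, E a u}"] by blast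
  have "E b x - E a x = (a - b) *\<^sub>R x" by (simp add: E_def algebra_simps)
  then have "x = inverse (a - b) *\<^sub>R (E b x - E a x)" using assms(1) by simp
  then have "E b x \<notin> span {E b w, E a u} \<or> E a x \<notin> span {E b w, E a u}"
    using x by (metis span_diff span_scale)
  then show ?thesis
  proof
    assume "E b x \<notin> span {E b w, E a u}"
    then have "E b x \<notin> span {E b w}" using span_mono[of "{E b w}" "{E b w, E a u}"] by blast
    then show ?thesis using orbit_J_double[OF assms(1) w _ u] eig ab ba by blast
  next
    assume "E a x \<notin> span {E b w, E a u}"
    then have "E a x \<notin> span {E a u}" using span_mono[of "{E a u}" "{E b w, E a u}"] by blast
    then show ?thesis using orbit_J_double[OF assms(1)[symmetric] u _ w] eig ab ba by blast
  qed
qed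

text \<open>
  With \<open>E = A - a\<close> and \<open>E u \<noteq> 0\<close>, the third basis vector must be an element of the kernel outside
  the line of \<open>E u\<close>. It comes from a vector \<open>x\<close> outside the span of \<open>u\<close> and \<open>E u\<close>: either \<open>E x\<close>
  leaves that line, or some \<open>x - k u\<close> lies in the kernel.
\<close>

lemma orbit_if_annihilated_by_square:
  fixes A :: "real^3^3"
  assumes A: "poly_mat ([:- a, 1:] * [:- a, 1:]) A = 0" and "poly_mat [:- a, 1:] A \<noteq> 0"
  shows "A \<in> orbit (J1 a a a)"
proof -
  define E where "E u = A *v u - a *\<^sub>R u" for u
  have EE: "E (E u) = 0" for u
    using A poly_mat_mult_vec[of "[:- a, 1:]" "[:- a, 1:]" A u] unfolding poly_mat_linear_vec E_def by simp
  obtain u where u: "E u \<noteq> 0"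
    using ex_vec_poly_mat_nonzero[OF assms(2)] unfolding poly_mat_linear_vec E_def by blast
  have lin: "E (x - k *\<^sub>R y) = E x - k *\<^sub>R E y" for x y k
    by (simp add: E_def matrix_vector_mult_diff_distrib matrix_vector_mult_scaleR algebra_simps)
  have "card {u, E u} \<le> 2" by (simp add: card_insert_if)
  then obtain x where x: "x \<notin> span {u, E u}" using ex_outside_span[of "{u, E u}"] by blast
  have "\<exists>v. E v = 0 \<and> v \<notin> span {E u}"
  proof (cases "E x \<in> span {E u}")
    case True
    then obtain k where "E x = k *\<^sub>R E u" by (auto simp: span_singleton)
    then have "E (x - k *\<^sub>R u) = 0" by (simp add: lin)
    moreover have "x - k *\<^sub>R u \<notin> span {E u}"
    proof
      assume "x - k *\<^sub>R u \<in> span {E u}"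
      then have "x - k *\<^sub>R u \<in> span {u, E u}" using span_mono[of "{E u}" "{u, E u}"] by blast
      moreover have "k *\<^sub>R u \<in> span {u, E u}" by (simp add: span_base span_scale)
      ultimately have "(x - k *\<^sub>R u) + k *\<^sub>R u \<in> span {u, E u}" by (rule span_add)
      then show False using x by simp
    qed
    ultimately show ?thesis by blast
  next
    case False
    then show ?thesis using EE by blast
  qed
  then obtain v where v: "E v = 0" "v \<notin> span {E u}" by blast
  show ?thesis
    by (rule orbit_J1_triple[OF u v(2), where ?v2.0 = u])
      (use EE[of u] v(1) in \<open>simp_all add: E_def\<close>)
qed

text \<open>
  In the cubic cases the minimal polynomial is as long as possible, and the vectors of the required
  basis are found by applying a proper factor to a vector that it does not annihilate.
\<close>

lemma orbit_cubic_distinct: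
  fixes A :: "real^3^3"
  assumes "a \<noteq> b" "a \<noteq> c" "b \<noteq> c"
    and A: "poly_mat ([:- a, 1:] * [:- b, 1:] * [:- c, 1:]) A = 0"
    and "poly_mat ([:- b, 1:] * [:- c, 1:]) A \<noteq> 0" "poly_mat ([:- a, 1:] * [:- c, 1:]) A \<noteq> 0"
      "poly_mat ([:- a, 1:] * [:- b, 1:]) A \<noteq> 0"
  shows "A \<in> orbit (J a b c)"
proof -
  have eig: "\<exists>v. v \<noteq> 0 \<and> A *v v = d *\<^sub>R v"
    if p: "poly_mat p A \<noteq> 0" "[:- d, 1:] * p = [:- a, 1:] * [:- b, 1:] * [:- c, 1:]" for d p
  proof -
    obtain u where u: "poly_mat p A *v u \<noteq> 0" using ex_vec_poly_mat_nonzero[OF p(1)] by blast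
    have "poly_mat [:- d, 1:] A *v (poly_mat p A *v u) = 0"
      using A by (simp only: p(2) poly_mat_mult_vec[symmetric] matrix_vector_mult_0)
    then have "A *v (poly_mat p A *v u) = d *\<^sub>R (poly_mat p A *v u)"
      unfolding poly_mat_linear_vec by simp
    with u show ?thesis by blast
  qed
  obtain v1 where "v1 \<noteq> 0" "A *v v1 = a *\<^sub>R v1"
    using eig[OF assms(5), of a] by (auto simp: mult_ac simp del: mult_pCons_left mult_pCons_right)
  moreover obtain v2 where "v2 \<noteq> 0" "A *v v2 = b *\<^sub>R v2"
    using eig[OF assms(6), of b] by (auto simp: mult_ac simp del: mult_pCons_left mult_pCons_right)
  moreover obtain v3 where "v3 \<noteq> 0" "A *v v3 = c *\<^sub>R v3"
    using eig[OF assms(7), of c] by (auto simp: mult_ac simp del: mult_pCons_left mult_pCons_right)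
  ultimately show ?thesis using orbit_J_distinct[OF assms(1-3)] by blast
qed

lemma orbit_cubic_double:
  fixes A :: "real^3^3"
  assumes "a \<noteq> b"
    and A: "poly_mat ([:- a, 1:] * [:- a, 1:] * [:- b, 1:]) A = 0"
    and "poly_mat ([:- a, 1:] * [:- b, 1:]) A \<noteq> 0" "poly_mat ([:- a, 1:] * [:- a, 1:]) A \<noteq> 0"
  shows "A \<in> orbit (J1 a a b)"
proof -
  define E where "E c u = A *v u - c *\<^sub>R u" for c u
  have vec: "poly_mat ([:- c, 1:] * [:- d, 1:]) A *v u = E c (E d u)" for c d u
    by (simp only: poly_mat_mult_vec poly_mat_linear_vec E_def)
  have aab: "E a (E a (E b u)) = 0" for u
  proof -
    have "E a (E a (E b u)) = poly_mat ([:- a, 1:] * [:- a, 1:] * [:- b, 1:]) A *v u"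
      by (simp only: poly_mat_mult_vec poly_mat_linear_vec E_def)
    then show ?thesis unfolding A by simp
  qed
  have baa: "E b (E a (E a u)) = 0" for u
  proof -
    have "E b (E a (E a u)) = poly_mat ([:- b, 1:] * ([:- a, 1:] * [:- a, 1:])) A *v u"
      by (simp only: poly_mat_mult_vec poly_mat_linear_vec E_def)
    then show ?thesis unfolding mult.commute[of "[:- b, 1:]"] A by simp
  qed
  obtain u where u: "E a (E b u) \<noteq> 0" using ex_vec_poly_mat_nonzero[OF assms(3)] unfolding vec by blast
  obtain w where w: "E a (E a w) \<noteq> 0" using ex_vec_poly_mat_nonzero[OF assms(4)] unfolding vec by blast
  have shift: "A *v x = E c x + c *\<^sub>R x" for c x by (simp add: E_def)
  show ?thesis
  proof (rule orbit_J1_double[OF assms(1) u w, where ?v2.0 = "E b u"])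
    show "A *v E a (E b u) = a *\<^sub>R E a (E b u)" using shift[of "E a (E b u)" a] aab[of u] by simp
    show "A *v E b u = E a (E b u) + a *\<^sub>R E b u" by (rule shift)
    show "A *v E a (E a w) = b *\<^sub>R E a (E a w)" using shift[of "E a (E a w)" b] baa[of w] by simp
  qed
qed

lemma orbit_cubic_triple:
  fixes A :: "real^3^3"
  assumes A: "poly_mat ([:- a, 1:] * [:- a, 1:] * [:- a, 1:]) A = 0"
    and "poly_mat ([:- a, 1:] * [:- a, 1:]) A \<noteq> 0"
  shows "A \<in> orbit (J2 a a a)"
proof -
  define E where "E u = A *v u - a *\<^sub>R u" for u
  have vec: "poly_mat ([:- a, 1:] * [:- a, 1:]) A *v u = E (E u)" for u
    by (simp only: poly_mat_mult_vec poly_mat_linear_vec E_def)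
  have EEE: "E (E (E u)) = 0" for u
  proof -
    have "E (E (E u)) = poly_mat ([:- a, 1:] * [:- a, 1:] * [:- a, 1:]) A *v u"
      by (simp only: poly_mat_mult_vec poly_mat_linear_vec E_def)
    then show ?thesis unfolding A by simp
  qed
  obtain u where u: "E (E u) \<noteq> 0" using ex_vec_poly_mat_nonzero[OF assms(2)] unfolding vec by blast
  have shift: "A *v x = E x + a *\<^sub>R x" for x by (simp add: E_def)
  show ?thesis
  proof (rule orbit_J2_triple[OF u, where ?v2.0 = "E u" and ?v3.0 = u])
    show "A *v E (E u) = a *\<^sub>R E (E u)" using shift[of "E (E u)"] EEE[of u] by simp
  qed (rule shift)+
qed

text \<open>
  On the kernel of the quadratic factor, \<open>(A - p)\<^sup>2 = - q\<^sup>2\<close>; so \<open>v2\<close> and \<open>v3 = (p - A) v2 / q\<close> are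
  rotated into each other by \<open>(A - p) / q\<close>.
\<close>

lemma orbit_cubic_complex:
  fixes A :: "real^3^3"
  assumes "0 < q"
    and A: "poly_mat ([:- a, 1:] * [:p\<^sup>2 + q\<^sup>2, - 2 * p, 1:]) A = 0"
    and "poly_mat [:p\<^sup>2 + q\<^sup>2, - 2 * p, 1:] A \<noteq> 0" "poly_mat [:- a, 1:] A \<noteq> 0"
  shows "A \<in> orbit (Jc a p q)"
proof -
  let ?Q = "[:p\<^sup>2 + q\<^sup>2, - 2 * p, 1:]"
  have Q: "poly_mat ?Q A *v u = A *v (A *v u) - (2 * p) *\<^sub>R (A *v u) + (p\<^sup>2 + q\<^sup>2) *\<^sub>R u" for u
    by (simp add: matrix_vector_mult_add_rdistrib matrix_vector_mult_diff_rdistrib matrix_add_ldistrib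
        matrix_mult_diff_right matrix_mult_scaleR_right scaleR_matrix_vector_assoc[symmetric]
        matrix_vector_mul_assoc[symmetric])
  obtain u where u: "poly_mat ?Q A *v u \<noteq> 0" using ex_vec_poly_mat_nonzero[OF assms(3)] by blast
  obtain w where w: "poly_mat [:- a, 1:] A *v w \<noteq> 0" using ex_vec_poly_mat_nonzero[OF assms(4)] by blast
  define v1 where "v1 = poly_mat ?Q A *v u"
  define v2 where "v2 = poly_mat [:- a, 1:] A *v w"
  define v3 where "v3 = inverse q *\<^sub>R (p *\<^sub>R v2 - A *v v2)"
  have "poly_mat [:- a, 1:] A *v v1 = 0"
    unfolding v1_def poly_mat_mult_vec[symmetric] A by simp
  then have v1: "A *v v1 = a *\<^sub>R v1" unfolding poly_mat_linear_vec by simp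
  have "poly_mat ?Q A *v v2 = 0"
    unfolding v2_def poly_mat_mult_vec[symmetric] mult.commute[of ?Q] A by simp
  then have AA: "A *v (A *v v2) = (2 * p) *\<^sub>R (A *v v2) - (p\<^sup>2 + q\<^sup>2) *\<^sub>R v2"
    unfolding Q by (simp add: algebra_simps eq_neg_iff_add_eq_0)
  have qv3: "q *\<^sub>R v3 = p *\<^sub>R v2 - A *v v2" using assms(1) by (simp add: v3_def)
  have "q *\<^sub>R (A *v v3) = A *v (q *\<^sub>R v3)" by (simp add: matrix_vector_mult_scaleR)
  also have "\<dots> = p *\<^sub>R (A *v v2) - A *v (A *v v2)"
    unfolding qv3 by (simp add: matrix_vector_mult_diff_distrib matrix_vector_mult_scaleR)
  also have "\<dots> = q *\<^sub>R (q *\<^sub>R v2) + p *\<^sub>R (q *\<^sub>R v3)"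
    unfolding AA qv3 by (simp add: vec_eq_iff algebra_simps power2_eq_square)
  also have "\<dots> = q *\<^sub>R (q *\<^sub>R v2 + p *\<^sub>R v3)" by (simp add: algebra_simps)
  finally have v3: "A *v v3 = q *\<^sub>R v2 + p *\<^sub>R v3" using assms(1) by simp
  show ?thesis
    by (rule orbit_Jc[OF _ _ _ v1 _ v3]) (use assms(1) u w qv3 in \<open>simp_all add: v1_def v2_def\<close>)
qed

section \<open>Centralizers of the normal forms\<close>

text \<open>
  Each centralizer is exhibited as the range of an injective linear parametrization.
\<close>

lemma dim_centralizer_param:
  fixes f :: "'a::euclidean_space \<Rightarrow> real^'n^'n"
  assumes lin: "linear f" and inj: "inj f"
    and sub: "\<And>v. f v ** B = B ** f v"
    and sup: "\<And>Z. Z ** B = B ** Z \<Longrightarrow> Z \<in> range f"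
  shows "dim (centralizer B) = DIM('a)"
proof -
  have "centralizer B = range f" using sub sup by (auto simp: centralizer_def)
  then show ?thesis using dim_image_eq[OF lin, of UNIV] inj by (simp add: dim_UNIV)
qed

lemmas matrix_3_simps = vec_eq_iff forall_3 matrix_matrix_mult_def sum_3

lemma dim_centralizer_J_distinct:
  assumes "a \<noteq> b" "a \<noteq> c" "b \<noteq> c"
  shows "dim (centralizer (J a b c)) = 3"
proof -
  let ?f = "\<lambda>v::real^3. J (v$1) (v$2) (v$3)"
  have "dim (centralizer (J a b c)) = DIM(real^3)"
  proof (rule dim_centralizer_param[of ?f])
    fix Z :: "real^3^3" assume "Z ** J a b c = J a b c ** Z"
    then have "Z = ?f (vector [Z$1$1, Z$2$2, Z$3$3])" using assms by (simp add: matrix_3_simps)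
    then show "Z \<in> range ?f" by blast
  qed (auto intro!: linearI injI simp: matrix_3_simps)
  then show ?thesis by simp
qed

lemma dim_centralizer_J_double:
  assumes "a \<noteq> b"
  shows "dim (centralizer (J a a b)) = 5"
proof -
  let ?f = "\<lambda>(u::real^3, w::real^2).
    (vector [vector [u$1, u$2, 0], vector [u$3, w$1, 0], vector [0, 0, w$2]] :: real^3^3)"
  have "dim (centralizer (J a a b)) = DIM((real^3) \<times> (real^2))"
  proof (rule dim_centralizer_param[of ?f])
    fix Z :: "real^3^3" assume "Z ** J a a b = J a a b ** Z"
    then have "Z = ?f (vector [Z$1$1, Z$1$2, Z$2$1], vector [Z$2$2, Z$3$3])"
      using assms by (simp add: matrix_3_simps)
    then show "Z \<in> range ?f" by blast
  qed (auto intro!: linearI injI simp: matrix_3_simps forall_2)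
  then show ?thesis by simp
qed

lemma dim_centralizer_J1_double:
  assumes "a \<noteq> b"
  shows "dim (centralizer (J1 a a b)) = 3"
proof -
  let ?f = "\<lambda>v::real^3. (vector [vector [v$1, v$2, 0], vector [0, v$1, 0], vector [0, 0, v$3]] :: real^3^3)"
  have "dim (centralizer (J1 a a b)) = DIM(real^3)"
  proof (rule dim_centralizer_param[of ?f])
    fix Z :: "real^3^3" assume "Z ** J1 a a b = J1 a a b ** Z"
    then have "Z = ?f (vector [Z$1$1, Z$1$2, Z$3$3])" using assms by (auto simp: matrix_3_simps)
    then show "Z \<in> range ?f" by blast
  qed (auto intro!: linearI injI simp: matrix_3_simps)
  then show ?thesis by simp
qed

lemma dim_centralizer_J_scalar: "dim (centralizer (J a a a)) = 9"
proof -
  have "dim (centralizer (J a a a)) = DIM(real^3^3)"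
    by (rule dim_centralizer_param[of id]) (auto intro!: linearI simp: matrix_3_simps)
  then show ?thesis by simp
qed

lemma dim_centralizer_J1_triple: "dim (centralizer (J1 a a a)) = 5"
proof -
  let ?f = "\<lambda>(u::real^3, w::real^2).
    (vector [vector [u$1, u$2, u$3], vector [0, u$1, 0], vector [0, w$1, w$2]] :: real^3^3)"
  have "dim (centralizer (J1 a a a)) = DIM((real^3) \<times> (real^2))"
  proof (rule dim_centralizer_param[of ?f])
    fix Z :: "real^3^3" assume "Z ** J1 a a a = J1 a a a ** Z"
    then have "Z = ?f (vector [Z$1$1, Z$1$2, Z$1$3], vector [Z$3$2, Z$3$3])"
      by (auto simp: matrix_3_simps)
    then show "Z \<in> range ?f" by blast
  qed (auto intro!: linearI injI simp: matrix_3_simps forall_2)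
  then show ?thesis by simp
qed

lemma dim_centralizer_J2_triple: "dim (centralizer (J2 a a a)) = 3"
proof -
  let ?f = "\<lambda>v::real^3. (vector [vector [v$1, v$2, v$3], vector [0, v$1, v$2], vector [0, 0, v$1]] :: real^3^3)"
  have "dim (centralizer (J2 a a a)) = DIM(real^3)"
  proof (rule dim_centralizer_param[of ?f])
    fix Z :: "real^3^3" assume "Z ** J2 a a a = J2 a a a ** Z"
    then have "Z = ?f (vector [Z$1$1, Z$1$2, Z$1$3])" by (auto simp: matrix_3_simps)
    then show "Z \<in> range ?f" by blast
  qed (auto intro!: linearI injI simp: matrix_3_simps)
  then show ?thesis by simp
qed

lemma dim_centralizer_Jc:
  assumes "q \<noteq> 0"
  shows "dim (centralizer (Jc a p q)) = 3"
proof -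
  let ?f = "\<lambda>v::real^3. Jc (v$1) (v$2) (v$3)"
  have "dim (centralizer (Jc a p q)) = DIM(real^3)"
  proof (rule dim_centralizer_param[of ?f])
    fix Z :: "real^3^3" assume Z: "Z ** Jc a p q = Jc a p q ** Z"
    have kill: "x = 0 \<and> y = 0" if "x * a = p * x + q * y" "y * a = p * y - q * x" for x y
    proof -
      have "((p - a)\<^sup>2 + q\<^sup>2) * x = 0" "((p - a)\<^sup>2 + q\<^sup>2) * y = 0" using that by algebra+
      moreover have "0 < (p - a)\<^sup>2 + q\<^sup>2" using assms by (simp add: add_nonneg_pos)
      ultimately show ?thesis by auto
    qed
    have eqs: "Z$2$1 * a = p * Z$2$1 + q * Z$3$1" "Z$3$1 * a = p * Z$3$1 - q * Z$2$1"
      "Z$1$3 * a = p * Z$1$3 + q * Z$1$2" "Z$1$2 * a = p * Z$1$2 - q * Z$1$3"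
      "q * (Z$3$2 + Z$2$3) = 0" "q * Z$2$2 = q * Z$3$3"
      using Z by (simp_all add: matrix_3_simps algebra_simps)
    have "Z$3$2 = - Z$2$3" "Z$2$2 = Z$3$3" using eqs(5,6) assms by simp_all
    then have "Z = ?f (vector [Z$1$1, Z$2$2, Z$2$3])"
      using kill[OF eqs(1,2)] kill[OF eqs(3,4)] by (simp add: matrix_3_simps)
    then show "Z \<in> range ?f" by blast
  qed (auto intro!: linearI injI simp: matrix_3_simps)
  then show ?thesis by simp
qed

section \<open>Real factors of polynomials\<close>

lemma degree_le_1_form:
  assumes "degree p \<le> 1"
  shows "\<exists>s t. p = [:s, t:]"
proof -
  obtain s p' where p: "p = pCons s p'" by (cases p)
  then have "degree p' = 0" using assms by (auto split: if_splits)
  then show ?thesis using p by (auto elim!: degree_eq_zeroE)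
qed

lemma monic_degree_le_2_cases:
  fixes r :: "real poly"
  assumes "lead_coeff r = 1" "degree r \<le> 2"
  shows "r = 1 \<or> (\<exists>b. r = [:- b, 1:]) \<or> (\<exists>b c. r = [:- b, 1:] * [:- c, 1:]) \<or>
    (\<exists>p q. 0 < q \<and> r = [:p\<^sup>2 + q\<^sup>2, - 2 * p, 1:])"
proof -
  consider "degree r = 0" | "degree r = 1" | "degree r = 2" using assms(2) by linarith
  then show ?thesis
  proof cases
    case 1
    then show ?thesis using assms(1) by (auto elim!: degree_eq_zeroE simp: one_pCons)
  next
    case 2
    then obtain s t where "r = [:s, t:]" using degree_le_1_form by (metis order_refl)
    then have "r = [:- (- s), 1:]" using 2 assms(1) by (auto split: if_splits)
    then show ?thesis by blast
  next
    case 3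
    obtain s r' where r': "r = pCons s r'" by (cases r)
    then have "degree r' = 1" using 3 by (auto split: if_splits)
    then obtain t w where "r' = [:t, w:]" using degree_le_1_form by (metis order_refl)
    then have r: "r = [:s, t, 1:]" using r' 3 assms(1) by (auto simp: numeral_2_eq_2 split: if_splits)
    show ?thesis
    proof (cases "4 * s \<le> t\<^sup>2")
      case True
      define d where "d = sqrt (t\<^sup>2 - 4 * s)"
      have d: "d\<^sup>2 = t\<^sup>2 - 4 * s" using True by (simp add: d_def)
      have "r = [:- ((- t + d) / 2), 1:] * [:- ((- t - d) / 2), 1:]"
        using d by (simp add: r field_simps power2_eq_square)
      then show ?thesis by blast
    next
      case False
      define q where "q = sqrt (4 * s - t\<^sup>2) / 2"
      have "0 < q" using False by (simp add: q_def)
      moreover have "q\<^sup>2 = (4 * s - t\<^sup>2) / 4" using False by (simp add: q_def power_divide)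
      then have "r = [:(- t / 2)\<^sup>2 + q\<^sup>2, - 2 * (- t / 2), 1:]"
        by (simp add: r power_divide field_simps)
      ultimately show ?thesis by blast
    qed
  qed
qed

lemma mult_linear_factor_dvd:
  fixes f :: "'a::idom poly"
  assumes "p dvd f" "poly f b = 0" "poly p b \<noteq> 0"
  shows "p * [:- b, 1:] dvd f"
proof -
  obtain g where g: "f = p * g" using assms(1) by blast
  then have "[:- b, 1:] dvd g" using assms(2,3) by (simp add: poly_eq_0_iff_dvd[symmetric])
  then show ?thesis unfolding g by (rule mult_dvd_mono[OF dvd_refl])
qed

lemma map_poly_of_real_mult:
  "map_poly complex_of_real (p * q) = map_poly complex_of_real p * map_poly complex_of_real q"
  by (intro poly_eqI) (simp add: coeff_map_poly coeff_mult)

lemma map_poly_of_real_add: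
  "map_poly complex_of_real (p + q) = map_poly complex_of_real p + map_poly complex_of_real q"
  by (intro poly_eqI) (simp add: coeff_map_poly)

lemma complex_root_quadratic:
  "complex_root [:p\<^sup>2 + q\<^sup>2, - 2 * p, 1:] (Complex p q)"
  by (simp add: map_poly_pCons complex_eq_iff algebra_simps power2_eq_square)

text \<open>
  The remainder is linear with real coefficients and vanishes at a non-real number.
\<close>

lemma quadratic_dvd_if_complex_root:
  assumes "q \<noteq> 0" "complex_root f (Complex p q)"
  shows "[:p\<^sup>2 + q\<^sup>2, - 2 * p, 1:] dvd f"
proof -
  let ?Q = "[:p\<^sup>2 + q\<^sup>2, - 2 * p, 1:]"
  have "f mod ?Q = 0 \<or> degree (f mod ?Q) < degree ?Q" by (rule degree_mod_less) simp
  then have "degree (f mod ?Q) \<le> 1" by auto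
  from degree_le_1_form[OF this] obtain s t where st: "f mod ?Q = [:s, t:]" by (elim exE)
  have "complex_root (f div ?Q * ?Q + f mod ?Q) (Complex p q)"
    using assms(2) by (simp only: div_mult_mod_eq)
  then have "complex_root [:s, t:] (Complex p q)"
    unfolding st map_poly_of_real_add map_poly_of_real_mult poly_add poly_mult complex_root_quadratic by simp
  then have "s + t * p = 0" "t * q = 0"
    by (simp_all add: map_poly_pCons complex_eq_iff algebra_simps)
  then have "f mod ?Q = 0" using assms(1) st by simp
  then show ?thesis by (simp only: dvd_eq_mod_eq_0)
qed

lemma complex_roots_if_quadratic_dvd:
  assumes "[:p\<^sup>2 + q\<^sup>2, - 2 * p, 1:] dvd f"
  shows "complex_root f (Complex p q)" "complex_root f (Complex p (- q))"
proof -
  obtain g where g: "f = [:p\<^sup>2 + q\<^sup>2, - 2 * p, 1:] * g" using assms by blast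
  show "complex_root f (Complex p q)"
    unfolding g map_poly_of_real_mult poly_mult complex_root_quadratic by simp
  show "complex_root f (Complex p (- q))"
    using complex_root_quadratic[of p "- q"] unfolding g map_poly_of_real_mult poly_mult by simp
qed

section \<open>Matrices annihilated by a polynomial\<close>

text \<open>
  The hypotheses on roots and multiplicities say precisely that the minimal polynomial of the normal
  form divides \<open>f\<close>.
\<close>

lemma class_annihilated:
  assumes "T \<in> classes f"
  shows "\<exists>B. T = orbit B \<and> poly_mat f B = 0 \<and> dim (centralizer B) \<in> {3, 5, 9}"
proof -
  note simps = poly_mat_mult matrix_3_simps mat_def
  have root: "[:- a, 1:] dvd f" if "poly f a = 0" for a
    using that by (simp add: poly_eq_0_iff_dvd)
  from assms consider
      (distinct) a b c where "T = sim_class (J a b c)" "poly f a = 0" "poly f b = 0" "poly f c = 0"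
        "a \<noteq> b" "a \<noteq> c" "b \<noteq> c"
    | (double) a b where "T = sim_class (J a a b)" "poly f a = 0" "poly f b = 0" "a \<noteq> b"
    | (double1) a b where "T = sim_class (J1 a a b)" "poly f a = 0" "poly f b = 0" "a \<noteq> b" "2 \<le> order a f"
    | (triple) a where "T = sim_class (J a a a)" "poly f a = 0"
    | (triple1) a where "T = sim_class (J1 a a a)" "poly f a = 0" "2 \<le> order a f"
    | (triple2) a where "T = sim_class (J2 a a a)" "poly f a = 0" "3 \<le> order a f"
    | (complex) a p q where "T = sim_class (Jc a p q)" "0 < q" "poly f a = 0" "complex_root f (Complex p q)"
    unfolding classes_def by blast
  then show ?thesis
  proof cases
    case distinct
    have "[:- a, 1:] * [:- b, 1:] * [:- c, 1:] dvd f"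
      using distinct
      by (intro mult_linear_factor_dvd root) (simp_all del: mult_pCons_left mult_pCons_right)
    moreover have "poly_mat ([:- a, 1:] * [:- b, 1:] * [:- c, 1:]) (J a b c) = 0"
      by (simp add: simps del: mult_pCons_left mult_pCons_right)
    ultimately have "poly_mat f (J a b c) = 0" by (rule poly_mat_eq_0_dvd)
    then show ?thesis
      using distinct dim_centralizer_J_distinct by (intro exI[of _ "J a b c"]) (simp add: sim_class_eq_orbit)
  next
    case double
    have "[:- a, 1:] * [:- b, 1:] dvd f"
      using double by (intro mult_linear_factor_dvd root) simp_all
    moreover have "poly_mat ([:- a, 1:] * [:- b, 1:]) (J a a b) = 0"
      by (simp add: simps del: mult_pCons_left mult_pCons_right)
    ultimately have "poly_mat f (J a a b) = 0" by (rule poly_mat_eq_0_dvd)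
    then show ?thesis
      using double dim_centralizer_J_double by (intro exI[of _ "J a a b"]) (simp add: sim_class_eq_orbit)
  next
    case double1
    have "[:- a, 1:] ^ 2 dvd f" using double1(5) by (simp only: order_divides) simp
    then have "[:- a, 1:] ^ 2 * [:- b, 1:] dvd f"
      using double1 by (intro mult_linear_factor_dvd) simp_all
    moreover have "poly_mat ([:- a, 1:] ^ 2 * [:- b, 1:]) (J1 a a b) = 0"
      by (simp add: simps power2_eq_square del: mult_pCons_left mult_pCons_right)
    ultimately have "poly_mat f (J1 a a b) = 0" by (rule poly_mat_eq_0_dvd)
    then show ?thesis
      using double1 dim_centralizer_J1_double by (intro exI[of _ "J1 a a b"]) (simp add: sim_class_eq_orbit)
  next
    case triple
    have "poly_mat [:- a, 1:] (J a a a) = 0" by (simp add: simps)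
    then have "poly_mat f (J a a a) = 0" by (rule poly_mat_eq_0_dvd[OF root[OF triple(2)]])
    then show ?thesis
      using triple dim_centralizer_J_scalar by (intro exI[of _ "J a a a"]) (simp add: sim_class_eq_orbit)
  next
    case triple1
    have "[:- a, 1:] ^ 2 dvd f" using triple1(3) by (simp only: order_divides) simp
    moreover have "poly_mat ([:- a, 1:] ^ 2) (J1 a a a) = 0"
      by (simp add: simps power2_eq_square del: mult_pCons_left mult_pCons_right)
    ultimately have "poly_mat f (J1 a a a) = 0" by (rule poly_mat_eq_0_dvd)
    then show ?thesis
      using triple1 dim_centralizer_J1_triple by (intro exI[of _ "J1 a a a"]) (simp add: sim_class_eq_orbit)
  next
    case triple2
    have "[:- a, 1:] ^ 3 dvd f" using triple2(3) by (simp only: order_divides) simp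
    moreover have "poly_mat ([:- a, 1:] ^ 3) (J2 a a a) = 0"
      by (simp add: simps power3_eq_cube del: mult_pCons_left mult_pCons_right)
    ultimately have "poly_mat f (J2 a a a) = 0" by (rule poly_mat_eq_0_dvd)
    then show ?thesis
      using triple2 dim_centralizer_J2_triple by (intro exI[of _ "J2 a a a"]) (simp add: sim_class_eq_orbit)
  next
    case complex
    have "poly [:p\<^sup>2 + q\<^sup>2, - 2 * p, 1:] a = (a - p)\<^sup>2 + q\<^sup>2"
      by (simp add: power2_eq_square algebra_simps)
    also have "\<dots> \<noteq> 0" using complex(2) by (simp add: sum_power2_eq_zero_iff)
    finally have "[:p\<^sup>2 + q\<^sup>2, - 2 * p, 1:] * [:- a, 1:] dvd f"
      using complex by (intro mult_linear_factor_dvd quadratic_dvd_if_complex_root) auto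
    moreover have "poly_mat ([:p\<^sup>2 + q\<^sup>2, - 2 * p, 1:] * [:- a, 1:]) (Jc a p q) = 0"
      by (simp add: simps algebra_simps power2_eq_square del: mult_pCons_left mult_pCons_right)
    ultimately have "poly_mat f (Jc a p q) = 0" by (rule poly_mat_eq_0_dvd)
    then show ?thesis
      using complex dim_centralizer_Jc[of q a p] by (intro exI[of _ "Jc a p q"]) (simp add: sim_class_eq_orbit)
  qed
qed

lemma classes_intros:
  "poly f a = 0 \<Longrightarrow> poly f b = 0 \<Longrightarrow> poly f c = 0 \<Longrightarrow> a \<noteq> b \<Longrightarrow> a \<noteq> c \<Longrightarrow> b \<noteq> c \<Longrightarrow>
    sim_class (J a b c) \<in> classes f"
  "poly f a = 0 \<Longrightarrow> poly f b = 0 \<Longrightarrow> a \<noteq> b \<Longrightarrow> sim_class (J a a b) \<in> classes f"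
  "poly f a = 0 \<Longrightarrow> poly f b = 0 \<Longrightarrow> a \<noteq> b \<Longrightarrow> 2 \<le> order a f \<Longrightarrow> sim_class (J1 a a b) \<in> classes f"
  "poly f a = 0 \<Longrightarrow> sim_class (J a a a) \<in> classes f"
  "poly f a = 0 \<Longrightarrow> 2 \<le> order a f \<Longrightarrow> sim_class (J1 a a a) \<in> classes f"
  "poly f a = 0 \<Longrightarrow> 3 \<le> order a f \<Longrightarrow> sim_class (J2 a a a) \<in> classes f"
  "0 < q \<Longrightarrow> poly f a = 0 \<Longrightarrow> complex_root f (Complex p q) \<Longrightarrow> complex_root f (Complex p (- q)) \<Longrightarrow>
    sim_class (Jc a p q) \<in> classes f"
  unfolding classes_def by blast+

text \<open>
  The minimal polynomial has degree at most \<open>3\<close> by Cayley--Hamilton and a real root \<open>a\<close>, because there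
  is a real eigenvector. Its cofactor of degree at most \<open>2\<close> is \<open>1\<close>, splits into real linear factors,
  or is an irreducible quadratic. Each factorization leaves a single normal form, except that for
  \<open>(x - a) (x - b)\<close> with \<open>a \<noteq> b\<close> either root may be the double eigenvalue. Since the minimal
  polynomial divides \<open>f\<close>, its roots are roots of \<open>f\<close> with at least the same multiplicities.
\<close>

lemma annihilated_in_class:
  fixes A :: "real^3^3"
  assumes f: "f \<noteq> 0" "poly_mat f A = 0"
  shows "\<exists>T\<in>classes f. A \<in> T"
proof -
  obtain m where m: "lead_coeff m = 1" "poly_mat m A = 0" "m dvd f"
    and least: "\<forall>p. p \<noteq> 0 \<longrightarrow> poly_mat p A = 0 \<longrightarrow> degree m \<le> degree p"
    using ex_minimal_poly[OF f] by blast
  have small: "poly_mat p A \<noteq> 0" if "p \<noteq> 0" "degree p < degree m" for p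
    using least that not_less by blast
  obtain k0 k1 k2 where "poly_mat [:k0, k1, k2, 1:] A = 0"
    using cayley_hamilton_3(1)[of A] by blast
  then have "degree m \<le> degree [:k0, k1, k2, 1:]" by (intro least[rule_format]) simp_all
  then have deg: "degree m \<le> 3" by simp
  obtain a u where u: "u \<noteq> 0" "A *v u = a *\<^sub>R u" using ex_real_eigenvector_3 by blast
  have "poly m a = 0" using poly_mat_eigenvector[OF u(2), of m] m(2) u(1) by simp
  then obtain r where r: "m = [:- a, 1:] * r" by (auto simp: poly_eq_0_iff_dvd)
  have "r \<noteq> 0" using r m(1) by auto
  then have degr: "degree m = Suc (degree r)" unfolding r by (subst degree_mult_eq) auto
  have "lead_coeff m = lead_coeff r" unfolding r lead_coeff_mult by simp
  then have lead: "lead_coeff r = 1" using m(1) by simp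
  have degr2: "degree r \<le> 2" using deg degr by simp
  have root: "poly f x = 0" if "poly m x = 0" for x using that m(3) by (auto simp: dvd_def)
  have ord: "n \<le> order x f" if "[:- x, 1:] ^ n dvd m" for x n
    using dvd_trans[OF that m(3)] f(1) by (simp only: order_divides) simp
  have dl: "degree ([:- x, 1:] * [:- y, 1:]) = 2" for x y :: real
    by (simp add: degree_mult_eq)
  have nz: "[:- x, 1:] * [:- y, 1:] \<noteq> 0" for x y :: real by simp
  note nosimp = mult_pCons_left mult_pCons_right
  show ?thesis
    using monic_degree_le_2_cases[OF lead degr2]
  proof (elim disjE exE conjE)
    assume "r = 1"
    then have "poly_mat [:- a, 1:] A = 0" using m(2) r by simp
    then have "A = J a a a" by (simp add: matrix_3_simps mat_def)
    then have "A \<in> sim_class (J a a a)" by (simp add: sim_class_eq_orbit self_in_orbit)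
    moreover have "poly f a = 0" by (rule root) (simp add: r)
    ultimately show ?thesis by (blast intro: classes_intros(4))
  next
    fix b assume b: "r = [:- b, 1:]"
    then have m2: "poly_mat ([:- a, 1:] * [:- b, 1:]) A = 0" using m(2) r by (simp only:)
    have ne: "poly_mat [:- x, 1:] A \<noteq> 0" for x by (rule small) (simp_all add: degr b)
    have fa: "poly f a = 0" "poly f b = 0" by (rule root, simp add: r b)+
    show ?thesis
    proof (cases "a = b")
      case True
      have "A \<in> sim_class (J1 a a a)"
        using orbit_if_annihilated_by_square[OF m2[folded True] ne] by (simp add: sim_class_eq_orbit)
      moreover have "2 \<le> order a f"
        by (rule ord) (simp only: r b True power2_eq_square dvd_refl)
      ultimately show ?thesis using fa by (blast intro: classes_intros(5))
    next
      case False
      have "A \<in> sim_class (J a a b) \<or> A \<in> sim_class (J b b a)"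
        using orbit_if_annihilated_by_two_roots[OF False m2 ne ne] by (simp add: sim_class_eq_orbit)
      then show ?thesis using classes_intros(2)[of f a b] classes_intros(2)[of f b a] fa False by auto
    qed
  next
    fix b c assume bc: "r = [:- b, 1:] * [:- c, 1:]"
    have m3: "m = [:- a, 1:] * [:- b, 1:] * [:- c, 1:]" unfolding r bc by (simp only: mult.assoc)
    then have deg3: "degree m = 3" using dl degr bc by simp
    have ne: "poly_mat ([:- x, 1:] * [:- y, 1:]) A \<noteq> 0" for x y
      using dl[of x y] deg3 by (intro small[OF nz]) linarith
    have roots: "poly f a = 0" "poly f b = 0" "poly f c = 0"
      by (rule root, simp add: m3 del: mult_pCons_left mult_pCons_right)+
    have two: "\<exists>T\<in>classes f. A \<in> T"
      if xy: "m = [:- x, 1:] * [:- x, 1:] * [:- y, 1:]" "x \<noteq> y" for x y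
    proof -
      have "A \<in> sim_class (J1 x x y)"
        using orbit_cubic_double[OF xy(2) m(2)[unfolded xy(1)] ne ne] by (simp add: sim_class_eq_orbit)
      moreover have "2 \<le> order x f"
        by (rule ord) (simp only: xy(1) power2_eq_square dvd_triv_left)
      moreover have "poly f x = 0" "poly f y = 0" 
        by (rule root, simp add: xy(1) del: mult_pCons_left mult_pCons_right)+
      ultimately show ?thesis using xy(2) by (blast intro: classes_intros(3))
    qed
    consider "a \<noteq> b" "a \<noteq> c" "b \<noteq> c" | "a = b" "b = c" | "a = b" "b \<noteq> c" | "a = c" "b \<noteq> c" | "b = c" "a \<noteq> b"
      by blast
    then show ?thesis
    proof cases
      case 1
      have "A \<in> sim_class (J a b c)"
        using orbit_cubic_distinct[OF 1 m(2)[unfolded m3] ne ne ne] by (simp add: sim_class_eq_orbit)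
      then show ?thesis using 1 roots by (blast intro: classes_intros(1))
    next
      case 2
      have m3': "m = [:- a, 1:] * [:- a, 1:] * [:- a, 1:]" using m3 2 by simp
      have "A \<in> sim_class (J2 a a a)"
        using orbit_cubic_triple[OF m(2)[unfolded m3'] ne] by (simp add: sim_class_eq_orbit)
      moreover have "3 \<le> order a f"
        by (rule ord) (simp only: m3' power3_eq_cube dvd_refl)
      ultimately show ?thesis using roots by (blast intro: classes_intros(6))
    next
      case 3
      then show ?thesis using two[of a c] m3 by simp
    next
      case 4
      then show ?thesis using two[of c b] m3 by (simp add: mult_ac del: nosimp)
    next
      case 5
      then show ?thesis using two[of b a] m3 by (simp add: mult_ac del: nosimp)
    qed
  next
    fix p q assume q: "0 < q" and rq: "r = [:p\<^sup>2 + q\<^sup>2, - 2 * p, 1:]"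
    have m3: "m = [:- a, 1:] * [:p\<^sup>2 + q\<^sup>2, - 2 * p, 1:]" unfolding r rq ..
    have deg3: "degree m = 3" using degr rq by simp
    have "A \<in> sim_class (Jc a p q)"
      unfolding sim_class_eq_orbit
      by (rule orbit_cubic_complex[OF q m(2)[unfolded m3]]; rule small) (simp_all add: deg3)
    moreover have "poly f a = 0" by (rule root) (simp add: m3)
    moreover have "[:p\<^sup>2 + q\<^sup>2, - 2 * p, 1:] dvd f"
      using m(3) unfolding m3 by (rule dvd_mult_right)
    ultimately show ?thesis
      using q complex_roots_if_quadratic_dvd[of p q f] by (blast intro: classes_intros(7))
  qed
qed

section \<open>Dimension of the solution set\<close>

text \<open>
  A pointwise Lipschitz map sends the union to a countable union of images of orbits, each of which is
  a null set.
\<close>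

lemma covering_dim_le_Union_orbits:
  fixes \<T> :: "(real^'n^'n) set set"
  assumes "countable \<T>"
    and orb: "\<And>T. T \<in> \<T> \<Longrightarrow> \<exists>B. T = orbit B \<and> DIM(real^'n^'n) < DIM('b::euclidean_space) + dim (centralizer B)"
  shows "covering_dim_le (top_of_set (\<Union>\<T>)) (int DIM('b) - 1)"
proof (rule covering_dim_le_if_lipschitz_images_negligible)
  fix F :: "real^'n^'n \<Rightarrow> 'b" assume F: "pointwise_lipschitz_on (\<Union>\<T>) F"
  have "negligible (F ` T)" if T: "T \<in> \<T>" for T
  proof -
    obtain B where B: "T = orbit B" "DIM(real^'n^'n) < DIM('b) + dim (centralizer B)"
      using orb[OF T] by blast
    have "pointwise_lipschitz_on T F" by (rule pointwise_lipschitz_on_subset[OF F]) (use T in blast)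
    then show ?thesis unfolding B(1) by (rule lipschitz_image_of_orbit_negligible[OF B(2)])
  qed
  then have "negligible (\<Union>T\<in>\<T>. F ` T)" using assms(1) by (intro negligible_countable_Union) auto
  then show "negligible (F ` \<Union>\<T>)" by (simp only: image_Union)
qed

text \<open>
  The case distinction is needed because the Euclidean spaces of dimension \<open>k\<close> and \<open>k + 1\<close> that serve
  as test spaces are types.
\<close>

lemma covering_dim_Union_orbits_3:
  fixes \<T> :: "(real^3^3) set set" and k :: nat
  assumes count: "countable \<T>" and k: "k \<in> {0, 4, 6}"
    and le: "\<And>T. T \<in> \<T> \<Longrightarrow> \<exists>B. T = orbit B \<and> 9 \<le> k + dim (centralizer B)"
    and eq: "orbit B \<in> \<T>" "k + dim (centralizer B) = 9"
  shows "covering_dim (top_of_set (\<Union>\<T>)) = ereal (real k)"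
proof -
  have sub: "orbit B \<subseteq> \<Union>\<T>" using eq(1) by blast
  have upper: "\<exists>B. T = orbit B \<and> DIM(real^3^3) < d + dim (centralizer B)" if "T \<in> \<T>" "d = k + 1" for T d
    using le[OF that(1)] that(2) by auto
  have "covering_dim_le (top_of_set (\<Union>\<T>)) (int k) \<and> \<not> covering_dim_le (top_of_set (\<Union>\<T>)) (int k - 1)"
  proof -
    consider "k = 0" | "k = 4" | "k = 6" using k by blast
    then show ?thesis
    proof cases
      case 1
      have "\<Union>\<T> \<noteq> {}" using sub self_in_orbit by blast
      then show ?thesis
        using covering_dim_le_Union_orbits[OF count upper, where 'b = real] 1
          not_covering_dim_le_minus_one[of "top_of_set (\<Union>\<T>)"] by simp
    next
      case 2
      then show ?thesis
        using covering_dim_le_Union_orbits[OF count upper, where 'b = "real^5"]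
          orbit_not_covering_dim_le[OF _ sub, where 'b = "real^4"] eq(2) by simp
    next
      case 3
      then show ?thesis
        using covering_dim_le_Union_orbits[OF count upper, where 'b = "real^7"]
          orbit_not_covering_dim_le[OF _ sub, where 'b = "real^6"] eq(2) by simp
    qed
  qed
  then show ?thesis using covering_dim_eqI[of "top_of_set (\<Union>\<T>)" "int k"] by simp
qed

lemma countable_classes:
  assumes "f \<noteq> 0"
  shows "countable (classes f)"
proof -
  define R where "R = {x. poly f x = 0}"
  define C where "C = {z. complex_root f z}"
  have "map_poly complex_of_real f \<noteq> 0" using assms by (simp add: map_poly_eq_0_iff)
  then have fin: "finite R" "finite C" unfolding R_def C_def using assms poly_roots_finite by blast+
  have "classes f \<subseteq>
      (\<lambda>(a, b, c). sim_class (J a b c)) ` (R \<times> R \<times> R) \<union> (\<lambda>(a, b, c). sim_class (J1 a b c)) ` (R \<times> R \<times> R) \<union>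
      (\<lambda>(a, b, c). sim_class (J2 a b c)) ` (R \<times> R \<times> R) \<union> (\<lambda>(a, z). sim_class (Jc a (Re z) (Im z))) ` (R \<times> C)"
    (is "_ \<subseteq> ?J \<union> ?J1 \<union> ?J2 \<union> ?Jc")
  proof
    fix T assume T: "T \<in> classes f"
    have J: "sim_class (J a b c) \<in> ?J" "sim_class (J1 a b c) \<in> ?J1" "sim_class (J2 a b c) \<in> ?J2"
      if "poly f a = 0" "poly f b = 0" "poly f c = 0" for a b c
      using that by (auto simp: R_def)
    have Jc: "sim_class (Jc a p q) \<in> ?Jc" if "poly f a = 0" "complex_root f (Complex p q)" for a p q
      using that by (auto simp: R_def C_def intro!: image_eqI[of _ _ "(a, Complex p q)"])
    show "T \<in> ?J \<union> ?J1 \<union> ?J2 \<union> ?Jc"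
      using T unfolding classes_def by (elim UnE CollectE exE conjE) (simp_all only: Un_iff J Jc simp_thms)
  qed
  then show ?thesis by (rule countable_subset) (use fin in \<open>simp add: countable_finite\<close>)
qed

lemma continuous_on_matpow: "continuous_on UNIV (\<lambda>X::real^'n^'n. matpow X k)"
  by (induction k)
    (auto intro!: continuous_on_const continuous_on_id bounded_bilinear.continuous_on[OF bounded_bilinear_matrix_mult])

lemma closed_solution_set: "closed (solution_set n a)"
proof -
  have "continuous_on UNIV (\<lambda>X::real^3^3. matpow X n + (\<Sum>i<n. a i *\<^sub>R matpow X i))"
    by (intro continuous_intros continuous_on_matpow)
  then show ?thesis
    unfolding solution_set_def by (intro closed_Collect_eq continuous_on_const)
qed

text \<open>
  The intersections with the closed balls of integer radius about an arbitrary centre are compact.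
\<close>

lemma sigma_compact_space_closed:
  fixes S :: "'a::heine_borel set"
  assumes "closed S"
  shows "sigma_compact_space (top_of_set S)"
  unfolding sigma_compact_space_def
proof (intro exI conjI ballI)
  let ?c = "undefined :: 'a"
  show "countable (range (\<lambda>n::nat. S \<inter> cball ?c (real n)))" by simp
  fix K assume "K \<in> range (\<lambda>n::nat. S \<inter> cball ?c (real n))"
  then show "compactin (top_of_set S) K"
    using assms by (auto simp: compactin_subtopology closed_Int_compact)
next
  let ?c = "undefined :: 'a"
  have "\<exists>n::nat. dist ?c x \<le> real n" for x by (rule real_arch_simple)
  then show "\<Union>(range (\<lambda>n::nat. S \<inter> cball ?c (real n))) = topspace (top_of_set S)" by auto
qed

lemma scalar_poly_nonzero: "scalar_poly n a \<noteq> 0"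
proof -
  have "coeff (\<Sum>i<n. monom (a i) i) n = 0" by (simp add: coeff_sum)
  then have "coeff (scalar_poly n a) n = 1" by (simp add: scalar_poly_def)
  then show ?thesis by auto
qed

lemma solution_set_eq_Union_classes: "solution_set n a = \<Union>(classes (scalar_poly n a))"
proof
  show "solution_set n a \<subseteq> \<Union>(classes (scalar_poly n a))"
    unfolding solution_set_eq using annihilated_in_class[OF scalar_poly_nonzero] by blast
  show "\<Union>(classes (scalar_poly n a)) \<subseteq> solution_set n a"
    unfolding solution_set_eq using class_annihilated poly_mat_orbit_eq_0 by blast
qed

theorem corollary4p7:
  fixes n :: nat and a :: "nat \<Rightarrow> real"
  assumes "n \<ge> 1"
  shows "sigma_compact_space (top_of_set (solution_set n a)) \<and>
    (\<forall>T \<in> classes (scalar_poly n a). covering_dim (top_of_set T) \<in> {0, 4, 6}) \<and>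
    (covering_dim (top_of_set (solution_set n a)) = - 1 \<or>
     classes (scalar_poly n a) \<noteq> {} \<and>
     covering_dim (top_of_set (solution_set n a)) =
       Max ((\<lambda>T. covering_dim (top_of_set T)) ` classes (scalar_poly n a)))"
proof -
  define \<T> where "\<T> = classes (scalar_poly n a)"
  have count: "countable \<T>" unfolding \<T>_def by (rule countable_classes[OF scalar_poly_nonzero])
  have "\<forall>T\<in>\<T>. \<exists>B. T = orbit B \<and> dim (centralizer B) \<in> {3, 5, 9}"
    using class_annihilated unfolding \<T>_def by blast
  from bchoice[OF this] obtain B
    where "\<forall>T\<in>\<T>. T = orbit (B T) \<and> dim (centralizer (B T)) \<in> {3, 5, 9}" ..
  then have B: "T = orbit (B T)" "dim (centralizer (B T)) \<in> {3, 5, 9}" if "T \<in> \<T>" for T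
    using that by blast+
  define k where "k T = 9 - dim (centralizer (B T))" for T
  have k: "k T \<in> {0, 4, 6}" "k T + dim (centralizer (B T)) = 9" if "T \<in> \<T>" for T
    using B(2)[OF that] by (auto simp: k_def)
  have dim_T: "covering_dim (top_of_set T) = ereal (real (k T))" if T: "T \<in> \<T>" for T
    using covering_dim_Union_orbits_3[of "{T}" "k T" "B T"] B(1)[OF T] k[OF T] by force
  have "covering_dim (top_of_set (\<Union>\<T>)) = Max ((\<lambda>T. covering_dim (top_of_set T)) ` \<T>)" if "\<T> \<noteq> {}"
  proof -
    have "k ` \<T> \<subseteq> {0, 4, 6}" by (rule image_subsetI) (rule k(1))
    then have fin: "finite (k ` \<T>)" by (rule finite_subset) simp
    have "Max (k ` \<T>) \<in> k ` \<T>" using fin that by (intro Max_in) simp_all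
    then obtain M where M: "Max (k ` \<T>) = k M" "M \<in> \<T>" by (rule imageE)
    have max: "k T \<le> k M" if "T \<in> \<T>" for T
      unfolding M(1)[symmetric] using fin that by (intro Max_ge) simp_all
    have "covering_dim (top_of_set (\<Union>\<T>)) = ereal (real (k M))"
    proof (rule covering_dim_Union_orbits_3[OF count k(1)[OF M(2)]])
      show "\<exists>B. T = orbit B \<and> 9 \<le> k M + dim (centralizer B)" if "T \<in> \<T>" for T
        using B(1)[OF that] k(2)[OF that] max[OF that] by (intro exI[of _ "B T"]) auto
      show "orbit (B M) \<in> \<T>" using B(1)[OF M(2)] M(2) by simp
      show "k M + dim (centralizer (B M)) = 9" by (rule k(2)[OF M(2)])
    qed
    moreover have "Max ((\<lambda>T. covering_dim (top_of_set T)) ` \<T>) = ereal (real (k M))"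
    proof (rule Max_eqI)
      have "(\<lambda>T. covering_dim (top_of_set T)) ` \<T> = (\<lambda>k. ereal (real k)) ` (k ` \<T>)"
        unfolding image_image using dim_T by (intro image_cong) auto
      then show "finite ((\<lambda>T. covering_dim (top_of_set T)) ` \<T>)" using fin by simp
      show "y \<le> ereal (real (k M))" if "y \<in> (\<lambda>T. covering_dim (top_of_set T)) ` \<T>" for y
        using that dim_T max by auto
      show "ereal (real (k M)) \<in> (\<lambda>T. covering_dim (top_of_set T)) ` \<T>"
        using dim_T[OF M(2)] M(2) by (metis imageI)
    qed
    ultimately show ?thesis by simp
  qed
  moreover have "covering_dim (top_of_set T) \<in> {0, 4, 6}" if "T \<in> \<T>" for T
    using dim_T[OF that] k(1)[OF that] by auto
  moreover have "sigma_compact_space (top_of_set (solution_set n a))"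
    by (rule sigma_compact_space_closed[OF closed_solution_set])
  moreover have "covering_dim (top_of_set (\<Union>\<T>)) = - 1" if "\<T> = {}"
    using that covering_dim_empty by simp
  ultimately show ?thesis
    unfolding solution_set_eq_Union_classes \<T>_def[symmetric] by blast
qed

end
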